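(* Let $V\subset\mathbb{P}^N$ be an irreducible projective variety of dimension $k$ over $\mathbb{C}$, let $t\ge 1$, and choose, near a general point of $V$, a Darboux frame $\{A_0;A_1,\dots,A_N\}$ such that $A_0,\dots,A_{d_s}$ span $\tilde T^{(s)}_P(V)$ for all $s=1,\dots,t$, with associated $1$-forms $\omega_i,\omega_{i,j}$. Then for $1\le s\le t$ the $(s+1)$-th fundamental form of $V$ is given by the polynomials $$V^{(s+1)}_{i^{(\ell)}}=\sum_{i_1^{(1)},\dots,i_{s+1}^{(1)}=1}^{k} q_{i_1^{(1)},\dots,i_{s+1}^{(1)};i^{(\ell)}}\,\omega_{i_1^{(1)}}\cdots\omega_{i_{s+1}^{(1)}},\qquad \ell\ge s+1,$$ whose coefficients $q_{i_1^{(1)},\dots,i_{s+1}^{(1)};i^{(\ell)}}$ are symmetric in the indices $i_1^{(1)},\dots,i_{s+1}^{(1)}$ and inductively satisfy the relations $$\sum_{i^{(s)}=d_{s-1}+1}^{d_s} q_{i_1^{(1)},\dots,i_s^{(1)};i^{(s)}}\,\omega_{i^{(s)},i^{(\ell)}}=\sum_{i_{s+1}^{(1)}=1}^{k} q_{i_1^{(1)},\dots,i_{s+1}^{(1)};i^{(\ell)}}\,\omega_{i_{s+1}^{(1)}},\qquad \ell\ge s+1,$$ where $q_{i_1^{(1)},\dots,i_s^{(1)};i^{(s)}}$ are the coefficients of the $s$-th fundamental form. The basis of the induction is $s=1$ (the second fundamental form), for which the polynomials and the relations are to be read respectively as $$V^{(2)}_{i^{(\ell)}}=\sum_{i_1^{(1)},i_2^{(1)}=1}^{k}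 q_{i_1^{(1)},i_2^{(1)};i^{(\ell)}}\,\omega_{i_1^{(1)}}\omega_{i_2^{(1)}},\qquad \omega_{i_1^{(1)},i^{(\ell)}}=\sum_{i_2^{(1)}=1}^{k} q_{i_1^{(1)},i_2^{(1)};i^{(\ell)}}\,\omega_{i_2^{(1)}},\qquad \ell\ge 2.$$
   Context: Linear subspaces of $\mathbb{P}^N$ are identified with the corresponding vector subspaces of $\mathbb{C}^{N+1}$. $T_P(V)$ is the Zariski tangent space of $V$ at $P$. Osculating spaces: near a general (smooth) point $P\in V$ let $A_0$ be a local holomorphic lift of $V$ to $\mathbb{C}^{N+1}\setminus\{0\}$. For $t\ge1$, the $t$-th osculating space $\tilde T^{(t)}_P(V)\subset\mathbb{P}^N$ is spanned by $A_0$ and all its partial derivatives of order at most $t$ at $P$ along $V$; $\tilde T^{(1)}_P(V)=\tilde T_P(V)$ is the embedded tangent space. For $P$ general, $d_t:=\dim\tilde T^{(t)}_P(V)$ (projective dimension), so $d_1=k$; put $d_0:=0$. Fundamental forms: for $t\ge2$ the $t$-th fundamental form at a general point $P$ is the linear map $I^t:\mathrm{Sym}^{t}T_P(V)\to\mathbb{C}^{N+1}/\tilde T^{(t-1)}_P(V)$, $v^t\mapsto \frac{d^tA_0}{dv^t}\bmod\tilde T^{(t-1)}_P(V)$. It is "given by polynomials" $V^{(t)}_j$, $d_{t-1}+1\le j\le N$, on $T_P(V)$ when these are its components in the basis $(A_j)_{j>d_{t-1}}$ of $\mathbb{C}^{N+1}/\tilde T^{(t-1)}_P(V)$; the corresponding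 linear system $|I^t|$ of degree $t$ hypersurfaces in $\mathbb{P}(T_P(V))$ is the one generated by the $V^{(t)}_j$. Darboux frames: a Darboux frame centred at $P$ is a basis $\{A_0;A_1,\dots,A_k;\dots,A_N\}$ of $\mathbb{C}^{N+1}$ such that $A_0$ represents $P$ and $A_0,\dots,A_k$ span $\tilde T_P(V)$. Letting the frame move, one has the structure equations $$\omega_\mu=0\ (\mu>k),\quad dA_0=\sum_{i=0}^k\omega_iA_i,\quad dA_i=\sum_{j=0}^N\omega_{i,j}A_j\ (1\le i\le N),$$ $$d\omega_j=\sum_{h=0}^k\omega_h\wedge\omega_{h,j}\ (0\le j\le k),\quad d\omega_{i,j}=\sum_{h=0}^N\omega_{i,h}\wedge\omega_{h,j}\ (1\le i\le N,\ 0\le j\le N),$$ where $\omega_i,\omega_{i,j}$ are the (restrictions to $V$ of the) Maurer–Cartan $1$-forms of the frame. The forms $\omega_1,\dots,\omega_k$ give a basis of the cotangent space $T_P^*(V)$, and products of the $\omega_i$ in the polynomials are symmetric products, i.e. the $\omega_1,\dots,\omega_k$ are regarded as linear coordinates on $T_P(V)$. Index ranges: $1\le i^{(1)},i^{(1)}_1,i^{(1)}_2,\dots\le k=d_1$; $d_{s-1}+1\le i^{(s)}\le d_s$ for $s=2,\dots,t$; and $d_t+1\le i^{(t+1)}\le N$. Thus $i^{(\ell)}$ with $\ell\ge s+1$ ranges over all integers from $d_s+1$ to $N$ as $\ell$ ranges over $s+1,\dots,t+1$. *)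

theory Defs
  imports "HOL-Complex_Analysis.Complex_Analysis" "HOL-Library.Poly_Mapping" "HOL-Library.Multiset"
begin

text \<open>
  Throughout, \<open>complex ^ 'n\<close> is the vector space of dimension \<open>N + 1 = CARD('n)\<close> whose lines are
  the points of projective \<open>N\<close>-space. Complex-linear notions are those of the library's
  interpretation \<open>vec\<close> for the scalar multiplication \<open>*s\<close>.
\<close>

definition pt :: "complex ^ 'n \<Rightarrow> (complex ^ 'n) set" where
  "pt x = vec.span {x}"

type_synonym 'n cpoly = "('n \<Rightarrow>\<^sub>0 nat) \<Rightarrow>\<^sub>0 complex"

definition eval_cpoly :: "('n::finite) cpoly \<Rightarrow> complex ^ 'n \<Rightarrow> complex" where
  "eval_cpoly f x = (\<Sum>m\<in>Poly_Mapping.keys f.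
     Poly_Mapping.lookup f m * (\<Prod>i\<in>UNIV. (x $ i) ^ Poly_Mapping.lookup m i))"

definition homogeneous :: "('n::finite) cpoly \<Rightarrow> bool" where
  "homogeneous f \<longleftrightarrow>
     (\<exists>e. \<forall>m\<in>Poly_Mapping.keys f. (\<Sum>i\<in>UNIV. Poly_Mapping.lookup m i) = e)"

definition zariski_closed :: "(complex ^ 'n::finite) set set \<Rightarrow> bool" where
  "zariski_closed Z \<longleftrightarrow> (\<exists>F. (\<forall>f\<in>F. homogeneous f) \<and>
     Z = {pt x | x. x \<noteq> 0 \<and> (\<forall>f\<in>F. eval_cpoly f x = 0)})"

definition irreducible_variety :: "(complex ^ 'n::finite) set set \<Rightarrow> bool" where
  "irreducible_variety V \<longleftrightarrow> zariski_closed V \<and> V \<noteq> {} \<and>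
     (\<forall>Z1 Z2. zariski_closed Z1 \<longrightarrow> zariski_closed Z2 \<longrightarrow> V = Z1 \<union> Z2 \<longrightarrow> V = Z1 \<or> V = Z2)"

definition irreducible_chain :: "(complex ^ 'n::finite) set set \<Rightarrow> nat \<Rightarrow> bool" where
  "irreducible_chain V m \<longleftrightarrow> (\<exists>Z. (\<forall>i\<le>m. irreducible_variety (Z i) \<and> Z i \<subseteq> V) \<and>
     (\<forall>i<m. Z i \<subset> Z (Suc i)))"

definition variety_dim :: "(complex ^ 'n::finite) set set \<Rightarrow> nat \<Rightarrow> bool" where
  "variety_dim V k \<longleftrightarrow> irreducible_chain V k \<and> \<not> irreducible_chain V (Suc k)"

text \<open>\<open>Q\<close> holds at the general point of the irreducible variety \<open>V\<close>, i.e. on a nonempty Zariski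
  open subset of \<open>V\<close>.\<close>

definition generically :: "(complex ^ 'n::finite) set set \<Rightarrow> ((complex ^ 'n) set \<Rightarrow> bool) \<Rightarrow> bool" where
  "generically V Q \<longleftrightarrow> (\<exists>Z. zariski_closed Z \<and> \<not> V \<subseteq> Z \<and> (\<forall>P\<in>V - Z. Q P))"

text \<open>Openness in \<open>V\<close> for the classical topology, which is the quotient topology from the nonzero
  vectors.\<close>

definition classically_open_in ::
    "(complex ^ 'n::finite) set set \<Rightarrow> (complex ^ 'n) set set \<Rightarrow> bool" where
  "classically_open_in V W \<longleftrightarrow> W \<subseteq> V \<and>
     openin (top_of_set {x. x \<noteq> 0 \<and> pt x \<in> V}) {x. x \<noteq> 0 \<and> pt x \<in> W}"

text \<open>
  The parameter space of a chart of a \<open>k\<close>-dimensional variety is a \<open>k\<close>-dimensional complex vector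
  space \<open>E\<close>. It is realised as a subspace of \<open>complex ^ 'n\<close>, which is possible since \<open>k \<le> N\<close>;
  in this way \<open>k\<close> is an ordinary number, and \<open>k = 0\<close> is allowed.
\<close>

definition holo_on ::
    "(complex ^ 'n::finite) set \<Rightarrow> (complex ^ 'n) set \<Rightarrow> (complex ^ 'n \<Rightarrow> complex ^ 'n) \<Rightarrow> bool" where
  "holo_on E U f \<longleftrightarrow> (\<forall>p\<in>U. \<exists>f'. (f has_derivative f') (at p within U) \<and>
     (\<forall>c. \<forall>v\<in>E. f' (c *s v) = c *s f' v))"

definition dir_deriv ::
    "complex ^ 'n::finite \<Rightarrow> (complex ^ 'n \<Rightarrow> complex ^ 'n) \<Rightarrow> complex ^ 'n \<Rightarrow> complex ^ 'n" where
  "dir_deriv v f p = (\<chi> i. deriv (\<lambda>h. f (p + h *s v) $ i) 0)"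

text \<open>A chart of \<open>V\<close>, given by a lift \<open>A0\<close> to nonzero vectors: \<open>pt \<circ> A0\<close> is an immersion and a
  homeomorphism from \<open>U\<close> onto an open subset of \<open>V\<close>. Its differential identifies \<open>E\<close> with the
  tangent space of \<open>V\<close> at \<open>pt (A0 p)\<close>, for every \<open>p \<in> U\<close>.\<close>

definition local_lift :: "(complex ^ 'n::finite) set set \<Rightarrow> nat \<Rightarrow> (complex ^ 'n) set \<Rightarrow>
    (complex ^ 'n) set \<Rightarrow> (complex ^ 'n \<Rightarrow> complex ^ 'n) \<Rightarrow> bool" where
  "local_lift V k E U A0 \<longleftrightarrow>
     vec.subspace E \<and> vec.dim E = k \<and> openin (top_of_set E) U \<and>
     holo_on E U A0 \<and> (\<forall>p\<in>U. A0 p \<noteq> 0) \<and>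
     inj_on (pt \<circ> A0) U \<and>
     (\<forall>W. openin (top_of_set U) W \<longrightarrow> classically_open_in V ((pt \<circ> A0) ` W)) \<and>
     (\<forall>p\<in>U. \<forall>v\<in>E. v \<noteq> 0 \<longrightarrow> dir_deriv v A0 p \<notin> vec.span {A0 p})"

text \<open>Derivatives along all vectors of \<open>E\<close> span the same space as the partial derivatives with
  respect to linear coordinates on \<open>E\<close>.\<close>

definition osc_space :: "(complex ^ 'n::finite) set \<Rightarrow> (complex ^ 'n \<Rightarrow> complex ^ 'n) \<Rightarrow> nat \<Rightarrow>
    complex ^ 'n \<Rightarrow> (complex ^ 'n) set" where
  "osc_space E A0 s p =
     vec.span {foldr dir_deriv vs A0 p | vs. set vs \<subseteq> E \<and> length vs \<le> s}"

text \<open>The number \<open>e\<close> is the projective dimension of the \<open>s\<close>-th osculating space at the general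
  point.\<close>

definition generic_osc_dim :: "(complex ^ 'n::finite) set set \<Rightarrow> nat \<Rightarrow> nat \<Rightarrow> nat \<Rightarrow> bool" where
  "generic_osc_dim V k s e \<longleftrightarrow> generically V (\<lambda>P. \<forall>E U A0. \<forall>p\<in>U.
     local_lift V k E U A0 \<longrightarrow> pt (A0 p) = P \<longrightarrow> vec.dim (osc_space E A0 s p) = e + 1)"

definition darboux_frame :: "(complex ^ 'n::finite) set set \<Rightarrow> nat \<Rightarrow> nat \<Rightarrow> (complex ^ 'n) set \<Rightarrow>
    (complex ^ 'n) set \<Rightarrow> (nat \<Rightarrow> complex ^ 'n \<Rightarrow> complex ^ 'n) \<Rightarrow> bool" where
  "darboux_frame V N k E U A \<longleftrightarrow>
     local_lift V k E U (A 0) \<and> (\<forall>i\<le>N. holo_on E U (A i)) \<and>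
     (\<forall>p\<in>U. inj_on (\<lambda>i. A i p) {0..N} \<and> vec.independent ((\<lambda>i. A i p) ` {0..N}) \<and>
        vec.span ((\<lambda>i. A i p) ` {0..N}) = UNIV \<and>
        vec.span ((\<lambda>i. A i p) ` {0..k}) = osc_space E (A 0) 1 p)"

text \<open>The forms \<open>\<omega> i\<close> and \<open>\<Omega> i j\<close> of a frame, evaluated at a point \<open>p\<close> and a tangent vector \<open>v\<close>.
  They are determined on \<open>E\<close> by the equations for \<open>dA\<^sub>0\<close> and \<open>dA\<^sub>i\<close>, where the sum for \<open>dA\<^sub>0\<close> stops at \<open>k\<close>
  because \<open>\<omega>\<^sub>\<mu> = 0\<close> for \<open>\<mu> > k\<close>. The equations for \<open>d\<omega>\<^sub>j\<close> and \<open>d\<omega>\<^sub>i\<^sub>j\<close> are consequences (\<open>d\<^sup>2 = 0\<close>).\<close>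

definition frame_forms :: "nat \<Rightarrow> nat \<Rightarrow> (complex ^ 'n::finite) set \<Rightarrow> (complex ^ 'n) set \<Rightarrow>
    (nat \<Rightarrow> complex ^ 'n \<Rightarrow> complex ^ 'n) \<Rightarrow> (nat \<Rightarrow> complex ^ 'n \<Rightarrow> complex ^ 'n \<Rightarrow> complex) \<Rightarrow>
    (nat \<Rightarrow> nat \<Rightarrow> complex ^ 'n \<Rightarrow> complex ^ 'n \<Rightarrow> complex) \<Rightarrow> bool" where
  "frame_forms N k E U A \<omega> \<Omega> \<longleftrightarrow> (\<forall>p\<in>U. \<forall>v\<in>E.
     dir_deriv v (A 0) p = (\<Sum>i=0..k. \<omega> i p v *s A i p) \<and>
     (\<forall>i\<in>{1..N}. dir_deriv v (A i) p = (\<Sum>j=0..N. \<Omega> i j p v *s A j p)))"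

text \<open>The value of the \<open>s\<close>-th fundamental form on the symmetric power \<open>v\<^sup>s\<close>, as a coset of the
  osculating space of order \<open>s - 1\<close>; these powers span the symmetric power of \<open>E\<close>.\<close>

definition fund_form :: "(complex ^ 'n::finite) set \<Rightarrow> (complex ^ 'n \<Rightarrow> complex ^ 'n) \<Rightarrow> nat \<Rightarrow>
    complex ^ 'n \<Rightarrow> complex ^ 'n \<Rightarrow> (complex ^ 'n) set" where
  "fund_form E A0 s p v = (+) ((dir_deriv v ^^ s) A0 p) ` osc_space E A0 (s - 1) p"

text \<open>The functions \<open>W j\<close> on \<open>E\<close>, \<open>e + 1 \<le> j \<le> N\<close>, are the components of the \<open>s\<close>-th fundamental form
  at \<open>p\<close> in the basis of the quotient space given by the classes of \<open>A j p\<close>.\<close>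

definition fund_form_given_by :: "nat \<Rightarrow> nat \<Rightarrow> (complex ^ 'n::finite) set \<Rightarrow>
    (nat \<Rightarrow> complex ^ 'n \<Rightarrow> complex ^ 'n) \<Rightarrow> nat \<Rightarrow> complex ^ 'n \<Rightarrow>
    (nat \<Rightarrow> complex ^ 'n \<Rightarrow> complex) \<Rightarrow> bool" where
  "fund_form_given_by N e E A s p W \<longleftrightarrow> (\<forall>v\<in>E. fund_form E (A 0) s p v =
     (+) (\<Sum>j=e+1..N. W j v *s A j p) ` osc_space E (A 0) (s - 1) p)"

text \<open>A multi-index is a list, so its order matters.\<close>

definition indices :: "nat \<Rightarrow> nat \<Rightarrow> nat list set" where
  "indices k r = {I. length I = r \<and> set I \<subseteq> {1..k}}"

end

theory Submission
  imports Defs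
begin

text \<open>  The coefficients are components, in the moving frame, of iterated derivatives of the lift. At a
  point \<open>p\<close> let \<open>e\<^sub>1, \<dots>, e\<^sub>k\<close> be the basis of the parameter space dual to \<open>\<omega>\<^sub>1, \<dots>, \<omega>\<^sub>k\<close>, kept fixed as a
  system of directions, and let \<open>q\<close> at the multi-index \<open>I = [i\<^sub>1, \<dots>, i\<^sub>r]\<close> and at \<open>j\<close> be the
  \<open>A\<^sub>j\<close>-component of \<open>D\<^sub>I A\<^sub>0\<close>, the derivative of \<open>A\<^sub>0\<close> at \<open>p\<close> along \<open>e\<close> at \<open>i\<^sub>1, \<dots>, i\<^sub>r\<close>. Derivatives along
  constant directions commute, hence \<open>q\<close> is symmetric (\<open>iterated_symmetric\<close>). Expanding
  \<open>v = \<Sum> \<omega>\<^sub>m(v) e\<^sub>m\<close> in the \<open>(s + 1)\<close>-fold derivative of \<open>A\<^sub>0\<close> along \<open>v\<close> gives the polynomials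
  (\<open>iterated_multilinear\<close>).

  The relations come from differentiating \<open>D\<^sub>I A\<^sub>0\<close>, with \<open>I\<close> of length \<open>s\<close>, once more along \<open>v\<close>. It is a
  section of the bundle of \<open>s\<close>-th osculating spaces, so \<open>D\<^sub>I A\<^sub>0 = \<Sum> c\<^sub>i A\<^sub>i\<close> with \<open>i\<close> up to \<open>d s\<close>.
  The terms with a derivative of some \<open>c\<^sub>i\<close> stay in that osculating space; for \<open>j\<close> above \<open>d s\<close> the \<open>A\<^sub>j\<close>-component of
  the derivative is therefore \<open>\<Sum> c\<^sub>i \<Omega>\<^sub>i\<^sub>j(v)\<close> (\<open>coord_derivative_section\<close>). The terms with \<open>i\<close> up to
  \<open>d (s - 1)\<close> drop out, because differentiating a section of one osculating bundle leads only into
  the next one (\<open>coord_derivative_frame_eq_0\<close>). This is the left-hand side of the relation; the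
  right-hand side arises from writing \<open>v\<close> in the basis \<open>e\<close>. For \<open>s = 1\<close> the \<open>c\<^sub>i\<close> are Kronecker symbols
  by the choice of \<open>e\<close>.

  Two points of analysis support this. A chart is only assumed to be complex differentiable once, so
  iterated derivatives must be shown to be holomorphic and to commute: Cauchy's integral formula on a
  disc in the direction \<open>w\<close> writes the derivative along \<open>w\<close> as an integral of the function, which may be
  differentiated under the integral sign (\<open>partial_has_derivative_integral\<close>). And the differentiability
  of the \<open>c\<^sub>i\<close> is circumvented: subtracting the combination of the \<open>A\<^sub>i\<close> with the constants \<open>c\<^sub>i(p)\<close>
  leaves a section vanishing at \<open>p\<close>, whose derivative at \<open>p\<close> is a limit of vectors in the span of
  the first \<open>d s + 1\<close> frame vectors and lies in that span because a determinant stays zero in the limit.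

  Generality of the point enters through the dimension formula for the osculating spaces, which
  forces \<open>d s \<le> N\<close>.\<close>

section \<open>Holomorphic functions of several variables\<close>

definition partial :: "complex ^ 'n::finite \<Rightarrow> (complex ^ 'n \<Rightarrow> complex) \<Rightarrow> complex ^ 'n \<Rightarrow> complex" where
  "partial v g p = deriv (\<lambda>h. g (p + h *s v)) 0"

text \<open>
  The derivative is required to be complex linear in all directions jointly. On an open set this is the
  several-variable notion of a holomorphic function.
\<close>

definition frechet_holomorphic_on :: "(complex ^ 'n::finite \<Rightarrow> complex) \<Rightarrow> (complex ^ 'n) set \<Rightarrow> bool" where
  "frechet_holomorphic_on g U \<longleftrightarrow>
     (\<forall>p\<in>U. \<exists>g'. (g has_derivative g') (at p) \<and> (\<forall>c v. g' (c *s v) = c * g' v))"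

lemma linear_imp_bounded_linear:
  fixes f :: "'a::euclidean_space \<Rightarrow> 'b::real_normed_vector"
  assumes "\<And>x y. f (x + y) = f x + f y" and "\<And>c x. f (c *\<^sub>R x) = c *\<^sub>R f x"
  shows "bounded_linear f"
  using assms by (intro linear_conv_bounded_linear[THEN iffD1] linearI)

lemma scaleR_eq_scale: "c *\<^sub>R (v :: complex ^ 'n) = of_real c *s v"
  by (simp add: vec_eq_iff scaleR_conv_of_real[where 'a=complex])

lemma bounded_linear_scale_left: "bounded_linear (\<lambda>z. z *s (w :: complex ^ 'n::finite))"
  by (rule linear_imp_bounded_linear)
    (simp_all add: vec_eq_iff algebra_simps)

lemma has_field_derivative_line:
  fixes g :: "complex ^ 'n::finite \<Rightarrow> complex"
  assumes "(g has_derivative g') (at (p + h *s v))" and "\<And>c. g' (c *s v) = c * g' v"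
  shows "((\<lambda>z. g (p + z *s v)) has_field_derivative g' v) (at h)"
proof -
  have "((\<lambda>z. p + z *s v) has_derivative (\<lambda>z. z *s v)) (at h)"
    by (auto intro!: derivative_eq_intros bounded_linear_imp_has_derivative bounded_linear_scale_left)
  from has_derivative_compose[OF this assms(1)]
  show ?thesis unfolding has_field_derivative_def
    by (simp add: assms(2) mult.commute[of _ "g' v"])
qed

lemma frechet_holomorphic_derivative:
  assumes "frechet_holomorphic_on g U" and "p \<in> U"
  shows "(g has_derivative (\<lambda>v. partial v g p)) (at p)"
    and "partial (c *s v) g p = c * partial v g p"
proof -
  obtain g' where g': "(g has_derivative g') (at p)" "\<And>c v. g' (c *s v) = c * g' v"
    using assms unfolding frechet_holomorphic_on_def by meson
  have eq: "partial v g p = g' v" for v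
    using has_field_derivative_line[of g g' p 0 v] g' unfolding partial_def
    by (intro DERIV_imp_deriv) simp
  show "(g has_derivative (\<lambda>v. partial v g p)) (at p)"
    using g'(1) by (simp add: eq)
  show "partial (c *s v) g p = c * partial v g p"
    by (simp add: eq g'(2))
qed

text \<open>
  Restricting to a complex line reduces matters to functions of one complex variable, to which
  Cauchy's formula applies.
\<close>

lemma frechet_holomorphic_line:
  assumes "frechet_holomorphic_on g U" and "p + h *s v \<in> U"
  shows "((\<lambda>z. g (p + z *s v)) has_field_derivative partial v g (p + h *s v)) (at h)"
  by (rule has_field_derivative_line)
    (use frechet_holomorphic_derivative[OF assms] in auto)

lemma frechet_holomorphic_continuous:
  "frechet_holomorphic_on g U \<Longrightarrow> continuous_on U g"
  by (meson continuous_at_imp_continuous_on frechet_holomorphic_derivative(1) has_derivative_continuous)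

lemma partial_bounded_linear:
  "frechet_holomorphic_on g U \<Longrightarrow> p \<in> U \<Longrightarrow> bounded_linear (\<lambda>v. partial v g p)"
  using frechet_holomorphic_derivative(1) has_derivative_bounded_linear by blast

abbreviation circ :: "real \<Rightarrow> real \<Rightarrow> complex" where
  "circ \<equiv> circlepath 0"

lemma circ_facts: 
  assumes "r > 0"
  shows "circ r x \<noteq> 0" "circ r x \<in> cball 0 r"
    "vector_derivative (circ r) (at x) = 2 * pi * \<i> * circ r x"
    "continuous_on S (circ r)"
  using assms unfolding vector_derivative_circlepath
  by (auto simp: circlepath norm_mult intro!: continuous_intros)

text \<open>
  Cauchy's formula for the first derivative at the centre of the disc. Parametrising the circle turns
  \<open>du / u\<^sup>2\<close> into \<open>2 \<pi> \<i> dx / u\<close>, which leaves a single factor \<open>u\<close> in the denominator.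
\<close>

lemma partial_Cauchy:
  assumes g: "frechet_holomorphic_on g U" and "r > 0" and "\<And>z. z \<in> cball 0 r \<Longrightarrow> p + z *s w \<in> U"
  shows "partial w g p = integral (cbox 0 1) (\<lambda>x. g (p + circ r x *s w) / circ r x)"
proof -
  let ?f = "\<lambda>z. g (p + z *s w)"
  have d: "(?f has_field_derivative partial w g (p + z *s w)) (at z)" if "z \<in> cball 0 r" for z
    using frechet_holomorphic_line[OF g] assms(3) that by blast
  have hol: "?f holomorphic_on cball 0 r"
    using d by (meson has_field_derivative_at_within holomorphic_on_def field_differentiable_def)
  have "2 * pi * \<i> * partial w g p = contour_integral (circ r) (\<lambda>u. ?f u / (u - 0)^2)"
    unfolding partial_def using \<open>r > 0\<close> hol
    by (subst Cauchy_contour_integral_circlepath_2)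
      (auto intro: holomorphic_on_imp_continuous_on holomorphic_on_subset)
  also have "\<dots> = integral {0..1} (\<lambda>x. 2 * pi * \<i> * (g (p + circ r x *s w) / circ r x))"
    unfolding contour_integral_integral
    by (rule integral_cong)
      (simp add: circ_facts[OF \<open>r > 0\<close>] power2_eq_square)
  also have "\<dots> = 2 * pi * \<i> * integral {0..1} (\<lambda>x. g (p + circ r x *s w) / circ r x)"
    by (rule integral_mult_right)
  finally show ?thesis by simp
qed

text \<open>
  A radius that serves all points near \<open>p0\<close> at once; the integrals over these circles then have a common
  domain, so that they can be differentiated in \<open>p\<close>.
\<close>

lemma discs_in_open:
  fixes U :: "(complex ^ 'n::finite) set"
  assumes "open U" and "p0 \<in> U"
  obtains r \<rho> where "r > 0" "\<rho> > 0"
    "\<And>p z. p \<in> ball p0 \<rho> \<Longrightarrow> z \<in> cball 0 r \<Longrightarrow> p + z *s w \<in> U"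
proof -
  obtain e where e: "e > 0" "ball p0 e \<subseteq> U"
    using assms open_contains_ball by blast
  obtain K where K: "K > 0" "\<And>z. norm (z *s w) \<le> norm (z :: complex) * K"
    using bounded_linear.pos_bounded[OF bounded_linear_scale_left[of w]] by blast
  show ?thesis
  proof (rule that[of "e / (2 * K)" "e / 2"])
    fix p z assume p: "p \<in> ball p0 (e/2)" and z: "z \<in> cball (0::complex) (e / (2 * K))"
    have "norm z * K \<le> e / 2"
      using z K(1) by (simp add: field_simps)
    then have "norm (z *s w) \<le> e / 2" using K(2)[of z] by linarith
    moreover have "dist p0 (p + z *s w) \<le> dist p0 p + norm (z *s w)"
      by (metis add_diff_cancel_left' dist_norm dist_triangle norm_minus_commute)
    ultimately have "dist p0 (p + z *s w) < e" using p by simp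
    then show "p + z *s w \<in> U" using e by auto
  qed (use e K in auto)
qed

lemma continuous_circ_shift:
  assumes "continuous_on U g" and "r > 0" and "\<And>p x. p \<in> S \<Longrightarrow> p + circ r x *s w \<in> U"
  shows "continuous_on (S \<times> cbox 0 1) (\<lambda>(p, x). g (p + circ r x *s (w :: complex ^ 'n::finite)) / circ r x :: complex)"
proof -
  have c: "continuous_on (S \<times> cbox 0 1) (\<lambda>a. circ r (snd a))"
    by (rule continuous_on_compose2[OF circ_facts(4)[OF \<open>r > 0\<close>, of UNIV]])
      (auto intro!: continuous_on_snd continuous_on_id)
  have "continuous_on (S \<times> cbox 0 1) (\<lambda>a. g (fst a + circ r (snd a) *s w))"
    by (rule continuous_on_compose2[OF assms(1)])
      (use assms(3) in \<open>auto intro!: continuous_intros c[unfolded cbox_interval] bounded_linear.continuous_on[OF bounded_linear_scale_left]\<close>)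
  then show ?thesis unfolding case_prod_beta
    using c circ_facts(1)[OF \<open>r > 0\<close>] by (intro continuous_intros) auto
qed

text \<open>
  Pointwise differentiability already makes the derivative continuous, because the integral in Cauchy's
  formula depends continuously on the point.
\<close>

lemma partial_continuous:
  assumes g: "frechet_holomorphic_on g U" and "open U"
  shows "continuous_on U (partial w g)"
proof (rule continuous_at_imp_continuous_on, rule ballI)
  fix p0 assume "p0 \<in> U"
  then obtain r \<rho> where r: "r > 0" "\<rho> > 0"
    "\<And>p z. p \<in> ball p0 \<rho> \<Longrightarrow> z \<in> cball 0 r \<Longrightarrow> p + z *s w \<in> U"
    using discs_in_open[OF \<open>open U\<close>] by metis
  have "continuous_on (ball p0 \<rho>) (\<lambda>p. integral (cbox 0 1) (\<lambda>x. g (p + circ r x *s w) / circ r x))"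
    by (rule integral_continuous_on_param, rule continuous_circ_shift[OF frechet_holomorphic_continuous[OF g]])
      (use r circ_facts[OF r(1)] in auto)
  then have "continuous_on (ball p0 \<rho>) (partial w g)"
    by (rule continuous_on_eq) (use partial_Cauchy[OF g r(1)] r(3) in metis)
  then show "continuous (at p0) (partial w g)"
    using r(2) by (simp add: continuous_on_eq_continuous_at)
qed

text \<open>
  Differentiation under the integral sign in Cauchy's formula. It needs the derivative of \<open>g\<close> to be
  continuous as an operator; in finite dimension this may be checked on basis vectors, where it
  is \<open>partial_continuous\<close>.
\<close>

theorem partial_has_derivative_integral:
  assumes g: "frechet_holomorphic_on g U" and "open U" and r: "r > 0" "\<rho> > 0"
    "\<And>p z. p \<in> ball p0 \<rho> \<Longrightarrow> z \<in> cball 0 r \<Longrightarrow> p + z *s w \<in> U"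
  shows "(partial w g has_derivative
     (\<lambda>v. integral (cbox 0 1) (\<lambda>x. partial v g (p0 + circ r x *s w) / circ r x))) (at p0)"
proof -
  note circ = circ_facts[OF r(1)]
  define G where "G p x = Blinfun (\<lambda>v. partial v g (p + circ r x *s w) / circ r x)" for p x
  have inU: "p + circ r x *s w \<in> U" if "p \<in> ball p0 \<rho>" for p x
    using r(3) that circ(2) by blast
  have G: "blinfun_apply (G p x) = (\<lambda>v. partial v g (p + circ r x *s w) / circ r x)" 
    if "p \<in> ball p0 \<rho>" for p x
    unfolding G_def
    by (rule bounded_linear_Blinfun_apply) 
      (rule bounded_linear_compose[OF bounded_linear_divide partial_bounded_linear[OF g inU[OF that]]])
  have contG: "continuous_on (ball p0 \<rho> \<times> cbox 0 1) (\<lambda>(p, x). G p x)"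
  proof (rule continuous_on_blinfun_componentwise)
    fix i :: "complex ^ 'a" assume "i \<in> Basis"
    have "continuous_on (ball p0 \<rho> \<times> cbox 0 1) (\<lambda>(p, x). partial i g (p + circ r x *s w) / circ r x)"
      by (rule continuous_circ_shift[OF partial_continuous[OF g \<open>open U\<close>] r(1) inU])
    then show "continuous_on (ball p0 \<rho> \<times> cbox 0 1) (\<lambda>a. blinfun_apply (case a of (p, x) \<Rightarrow> G p x) i)"
      by (rule continuous_on_eq) (auto simp: G)
  qed
  have contg: "continuous_on (ball p0 \<rho> \<times> cbox 0 1) (\<lambda>(p, x). g (p + circ r x *s w) / circ r x)"
    by (rule continuous_circ_shift[OF frechet_holomorphic_continuous[OF g] r(1) inU])
  have p0: "p0 \<in> ball p0 \<rho>" using r by simp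
  have sl: "continuous_on (cbox 0 1) (\<lambda>x. f p x)" if "p \<in> ball p0 \<rho>"
    "continuous_on (ball p0 \<rho> \<times> cbox 0 1) (\<lambda>(p, x). f p x)" for f :: "complex^'a \<Rightarrow> real \<Rightarrow> 'b::topological_space" and p
  proof -
    have "continuous_on (cbox 0 1) (\<lambda>x. case (p, x) of (p, x) \<Rightarrow> f p x)"
      by (rule continuous_on_compose2[OF that(2)]) (use that(1) in \<open>auto intro!: continuous_intros\<close>)
    then show ?thesis by simp
  qed
  have "((\<lambda>p. integral (cbox 0 1) (\<lambda>x. g (p + circ r x *s w) / circ r x)) has_derivative
      blinfun_apply (integral (cbox 0 1) (G p0))) (at p0 within ball p0 \<rho>)"
  proof (rule leibniz_rule[OF _ _ contG p0 convex_ball])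
    fix p and x :: real assume p: "p \<in> ball p0 \<rho>"
    have "(g has_derivative (\<lambda>v. partial v g (p + circ r x *s w))) (at (p + circ r x *s w))"
      by (rule frechet_holomorphic_derivative(1)[OF g inU[OF p]])
    then have "((\<lambda>p. g (p + circ r x *s w)) has_derivative (\<lambda>v. partial v g (p + circ r x *s w))) (at p)"
      by (rule has_derivative_compose[rotated]) (auto intro!: derivative_eq_intros)
    from has_derivative_at_withinI[OF bounded_linear.has_derivative[OF bounded_linear_divide this]]
    show "((\<lambda>p. g (p + circ r x *s w) / circ r x) has_derivative blinfun_apply (G p x)) (at p within ball p0 \<rho>)"
      unfolding G[OF p] .
  qed (use sl[OF _ contg] in \<open>auto intro!: integrable_continuous_interval\<close>)
  moreover have "blinfun_apply (integral (cbox 0 1) (G p0)) =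
      (\<lambda>v. integral (cbox 0 1) (\<lambda>x. partial v g (p0 + circ r x *s w) / circ r x))"
    by (rule ext, subst blinfun_apply_integral)
      (use sl[OF p0 contG] in \<open>auto intro!: integrable_continuous_interval simp: G[OF p0]\<close>)
  ultimately have "((\<lambda>p. integral (cbox 0 1) (\<lambda>x. g (p + circ r x *s w) / circ r x)) has_derivative
      (\<lambda>v. integral (cbox 0 1) (\<lambda>x. partial v g (p0 + circ r x *s w) / circ r x))) (at p0)"
    by (simp only: at_within_open[OF p0 open_ball])
  then show ?thesis
    by (rule has_derivative_transform_within_open[OF _ open_ball p0])
      (use partial_Cauchy[OF g r(1)] r(3) in metis)
qed

text \<open>
  The integral expression for the derivative of \<open>partial w g\<close> is complex linear in \<open>v\<close> because its
  integrand is.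
\<close>

theorem frechet_holomorphic_partial:
  assumes g: "frechet_holomorphic_on g U" and "open U"
  shows "frechet_holomorphic_on (partial w g) U"
  unfolding frechet_holomorphic_on_def
proof
  fix p0 assume "p0 \<in> U"
  then obtain r \<rho> where r: "r > 0" "\<rho> > 0"
    "\<And>p z. p \<in> ball p0 \<rho> \<Longrightarrow> z \<in> cball 0 r \<Longrightarrow> p + z *s w \<in> U"
    using discs_in_open[OF \<open>open U\<close>] by metis
  have "partial (c *s v) g (p0 + circ r x *s w) = c * partial v g (p0 + circ r x *s w)" for c v x
    by (rule frechet_holomorphic_derivative(2)[OF g r(3)]) (use r circ_facts[OF r(1)] in auto)
  then have "integral (cbox 0 1) (\<lambda>x. partial (c *s v) g (p0 + circ r x *s w) / circ r x)
      = c * integral (cbox 0 1) (\<lambda>x. partial v g (p0 + circ r x *s w) / circ r x)" for c v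
    by (simp flip: times_divide_eq_right)
  then show "\<exists>g'. (partial w g has_derivative g') (at p0) \<and> (\<forall>c v. g' (c *s v) = c * g' v)"
    using partial_has_derivative_integral[OF g \<open>open U\<close> r] by blast
qed

text \<open>
  The integral obtained by differentiating Cauchy's formula for \<open>partial w g\<close> along \<open>v\<close> is Cauchy's
  formula for the derivative of \<open>partial v g\<close> along \<open>w\<close>.
\<close>

theorem partial_commute:
  assumes g: "frechet_holomorphic_on g U" and "open U" and "p0 \<in> U"
  shows "partial v (partial w g) p0 = partial w (partial v g) p0"
proof -
  obtain r \<rho> where r: "r > 0" "\<rho> > 0"
    "\<And>p z. p \<in> ball p0 \<rho> \<Longrightarrow> z \<in> cball 0 r \<Longrightarrow> p + z *s w \<in> U"
    using discs_in_open[OF \<open>open U\<close> \<open>p0 \<in> U\<close>] by metis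
  have "partial v (partial w g) p0 = integral (cbox 0 1) (\<lambda>x. partial v g (p0 + circ r x *s w) / circ r x)"
    by (rule fun_cong[OF has_derivative_unique[OF
        frechet_holomorphic_derivative(1)[OF frechet_holomorphic_partial[OF g \<open>open U\<close>] \<open>p0 \<in> U\<close>]
        partial_has_derivative_integral[OF g \<open>open U\<close> r]]])
  also have "\<dots> = partial w (partial v g) p0"
    by (rule partial_Cauchy[OF frechet_holomorphic_partial[OF g \<open>open U\<close>] r(1), symmetric])
      (use r in auto)
  finally show ?thesis .
qed

section \<open>Holomorphic maps on a chart\<close>

lemma dir_deriv_nth:
  fixes f :: "complex ^ 'n::finite \<Rightarrow> complex ^ 'n"
  shows "dir_deriv v f p $ i = partial v (\<lambda>x. f x $ i) p"
  by (simp add: dir_deriv_def partial_def)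

text \<open>
  A chart is parametrised by a relatively open subset of a subspace \<open>E\<close>. Composing with a complex linear
  projection onto \<open>E\<close> turns maps on \<open>U\<close> into maps on the open set \<open>proj -` U\<close> with the same derivatives
  along \<open>E\<close>, so the theory of holomorphic functions on open sets applies.
\<close>

locale parameter_domain =
  fixes E U :: "(complex ^ 'n::finite) set"
  assumes subspace: "vec.subspace E" and open_in: "openin (top_of_set E) U"
begin

lemma U_subset: "U \<subseteq> E"
  using open_in openin_imp_subset by blast

definition proj :: "complex ^ 'n \<Rightarrow> complex ^ 'n" where
  "proj = (SOME \<pi>. range \<pi> \<subseteq> E \<and> Vector_Spaces.linear (*s) (*s) \<pi> \<and> (\<forall>v\<in>E. \<pi> v = v))"

lemma proj_ex: "range proj \<subseteq> E \<and> Vector_Spaces.linear (*s) (*s) proj \<and> (\<forall>v\<in>E. proj v = v)"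
proof -
  have "\<exists>\<pi>. range \<pi> \<subseteq> E \<and> Vector_Spaces.linear (*s) (*s) \<pi> \<and> (\<forall>v\<in>E. \<pi> v = v)"
    using vec.linear_exists_left_inverse_on[OF vec.linear_id subspace inj_on_id] by simp
  from someI_ex[OF this] show ?thesis
    unfolding proj_def .
qed

lemma proj_in: "proj x \<in> E" and proj_id: "v \<in> E \<Longrightarrow> proj v = v"
  and proj_add: "proj (x + y) = proj x + proj y" and proj_scale: "proj (c *s x) = c *s proj x"
  using proj_ex by (auto simp: Vector_Spaces.linear_iff)

lemma bounded_linear_proj: "bounded_linear proj"
  by (rule linear_imp_bounded_linear) (simp_all add: proj_add proj_scale scaleR_eq_scale)

lemma open_proj_vimage: "open (proj -` U)"
proof -
  obtain T where T: "open T" "U = E \<inter> T"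
    using open_in by (auto simp: openin_open)
  have "proj -` U = proj -` T"
    using T(2) proj_in by blast
  then show ?thesis
    using open_vimage[OF T(1) bounded_linear.continuous_on[OF bounded_linear_proj continuous_on_id]] by simp
qed

lemma U_vimage: "p \<in> U \<Longrightarrow> p \<in> proj -` U"
  using U_subset proj_id by auto

lemma frechet_holomorphic_extension:
  fixes f :: "complex ^ 'n \<Rightarrow> complex ^ 'n"
  assumes "holo_on E U f"
  shows "frechet_holomorphic_on (\<lambda>x. f (proj x) $ i) (proj -` U)"
  unfolding frechet_holomorphic_on_def
proof
  fix q assume q: "q \<in> proj -` U"
  obtain f' where f': "(f has_derivative f') (at (proj q) within U)"
      "\<And>c v. v \<in> E \<Longrightarrow> f' (c *s v) = c *s f' v"
    using assms q unfolding holo_on_def by (metis vimageE)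
  have "((\<lambda>x. f (proj x)) has_derivative (\<lambda>v. f' (proj v))) (at q within proj -` U)"
    by (rule has_derivative_in_compose[OF bounded_linear_imp_has_derivative[OF bounded_linear_proj]])
      (auto intro: has_derivative_subset[OF f'(1)])
  then have "((\<lambda>x. f (proj x)) has_derivative (\<lambda>v. f' (proj v))) (at q)"
    by (simp add: at_within_open[OF q open_proj_vimage])
  from bounded_linear.has_derivative[OF bounded_linear_vec_nth this]
  show "\<exists>g'. ((\<lambda>x. f (proj x) $ i) has_derivative g') (at q) \<and> (\<forall>c v. g' (c *s v) = c * g' v)"
    by (intro exI conjI) (auto simp: proj_scale f'(2) proj_in)
qed

lemma holo_on_of_extension:
  fixes f :: "complex ^ 'n \<Rightarrow> complex ^ 'n"
  assumes "\<And>i. frechet_holomorphic_on (\<lambda>x. f (proj x) $ i) (proj -` U)"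
  shows "holo_on E U f"
  unfolding holo_on_def
proof
  fix p assume p: "p \<in> U"
  define f' where "f' v = (\<chi> i. partial v (\<lambda>x. f (proj x) $ i) p)" for v
  note D = frechet_holomorphic_derivative[OF assms U_vimage[OF p]]
  have "((\<lambda>x. f (proj x)) has_derivative f') (at p)"
    unfolding has_derivative_componentwise_within[of _ f']
    by (auto simp: Basis_vec_def inner_axis f'_def intro!: derivative_eq_intros D(1))
  then have "(f has_derivative f') (at p within U)"
    by (intro has_derivative_transform[OF p _ has_derivative_at_withinI])
      (use U_subset proj_id in auto)
  then show "\<exists>f'. (f has_derivative f') (at p within U) \<and> (\<forall>c. \<forall>v\<in>E. f' (c *s v) = c *s f' v)"
    by (intro exI[of _ f'] conjI) (auto simp: f'_def vec_eq_iff D(2))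
qed

lemma dir_deriv_proj:
  fixes f :: "complex ^ 'n \<Rightarrow> complex ^ 'n"
  shows "v \<in> E \<Longrightarrow> dir_deriv v f (proj x) $ i = partial v (\<lambda>x. f (proj x) $ i) x"
  by (simp add: dir_deriv_nth partial_def proj_add proj_scale proj_id)

theorem holo_on_dir_deriv:
  assumes "holo_on E U f" and "v \<in> E"
  shows "holo_on E U (dir_deriv v f)"
  using frechet_holomorphic_partial[OF frechet_holomorphic_extension[OF assms(1)] open_proj_vimage]
  by (intro holo_on_of_extension) (simp add: dir_deriv_proj[OF assms(2)])

lemma dir_deriv_eq_partial:
  fixes f :: "complex ^ 'n \<Rightarrow> complex ^ 'n"
  shows "p \<in> U \<Longrightarrow> v \<in> E \<Longrightarrow> dir_deriv v f p $ i = partial v (\<lambda>x. f (proj x) $ i) p"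
  using dir_deriv_proj[of v f p] U_subset proj_id by auto

theorem dir_deriv_commute:
  assumes "holo_on E U f" and "p \<in> U" and "v \<in> E" and "w \<in> E"
  shows "dir_deriv v (dir_deriv w f) p = dir_deriv w (dir_deriv v f) p"
  using partial_commute[OF frechet_holomorphic_extension[OF assms(1)] open_proj_vimage U_vimage[OF assms(2)]]
  by (simp add: vec_eq_iff dir_deriv_eq_partial[OF assms(2)] dir_deriv_proj assms)

lemma line_mem: "p \<in> U \<Longrightarrow> v \<in> E \<Longrightarrow> eventually (\<lambda>h. p + h *s v \<in> U) (nhds 0)"
proof -
  assume p: "p \<in> U" and v: "v \<in> E"
  obtain T where T: "open T" "U = E \<inter> T"
    using open_in by (auto simp: openin_open)
  have "open ((\<lambda>h. p + h *s v) -` T)"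
    by (intro open_vimage T continuous_intros
        bounded_linear.continuous_on[OF bounded_linear_scale_left])
  moreover have "0 \<in> (\<lambda>h. p + h *s v) -` T" using p T by simp
  moreover have "p + h *s v \<in> E" for h
    using p v T subspace by (simp add: vec.subspace_add vec.subspace_scale)
  ultimately show ?thesis
    using T(2) unfolding eventually_nhds by blast
qed

text \<open>
  A directional derivative along \<open>E\<close> at a point of \<open>U\<close> only sees values on \<open>U\<close>. Identities between iterated
  derivatives hold on \<open>U\<close> only, and this allows them to be differentiated.
\<close>

lemma dir_deriv_cong:
  assumes "p \<in> U" and "v \<in> E" and "\<And>q. q \<in> U \<Longrightarrow> f q = g q"
  shows "dir_deriv v f p = dir_deriv v g p"
proof -
  have "eventually (\<lambda>h. f (p + h *s v) = g (p + h *s v)) (nhds 0)"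
    using line_mem[OF assms(1,2)] by eventually_elim (rule assms(3))
  then show ?thesis unfolding dir_deriv_def
    by (auto simp: vec_eq_iff intro!: deriv_cong_ev elim!: eventually_mono)
qed

lemma has_field_derivative_dir_deriv:
  fixes f :: "complex ^ 'n \<Rightarrow> complex ^ 'n"
  assumes "holo_on E U f" and "p \<in> U" and "v \<in> E"
  shows "((\<lambda>h. f (p + h *s v) $ i) has_field_derivative dir_deriv v f p $ i) (at 0)"
proof -
  have "((\<lambda>h. f (proj (p + h *s v)) $ i) has_field_derivative
      partial v (\<lambda>x. f (proj x) $ i) (p + 0 *s v)) (at 0)"
    by (rule frechet_holomorphic_line[OF frechet_holomorphic_extension[OF assms(1)]])
      (simp add: U_vimage[OF assms(2), simplified])
  moreover have "proj (p + h *s v) = p + h *s v" for h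
    using assms U_subset by (auto simp: proj_add proj_scale proj_id)
  ultimately show ?thesis
    by (simp add: dir_deriv_eq_partial assms)
qed

lemma dir_deriv_add:
  assumes "holo_on E U f" and "p \<in> U" and "v \<in> E" and "w \<in> E"
  shows "dir_deriv (v + w) f p = dir_deriv v f p + dir_deriv w f p"
  using assms(2-4) vec.subspace_add[OF subspace assms(3,4)]
    linear_add[OF bounded_linear.linear[OF partial_bounded_linear[OF
        frechet_holomorphic_extension[OF assms(1)] U_vimage[OF assms(2)]]]]
  by (simp add: vec_eq_iff dir_deriv_eq_partial)

lemma dir_deriv_scale:
  assumes "holo_on E U f" and "p \<in> U" and "v \<in> E"
  shows "dir_deriv (c *s v) f p = c *s dir_deriv v f p"
  using assms(2,3) vec.subspace_scale[OF subspace assms(3)]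
    frechet_holomorphic_derivative(2)[OF frechet_holomorphic_extension[OF assms(1)] U_vimage[OF assms(2)]]
  by (simp add: vec_eq_iff dir_deriv_eq_partial)

lemma dir_deriv_linear_sum:
  assumes "holo_on E U f" and "p \<in> U" and "\<And>i. i \<in> I \<Longrightarrow> v i \<in> E" and "finite I"
  shows "dir_deriv (\<Sum>i\<in>I. c i *s v i) f p = (\<Sum>i\<in>I. c i *s dir_deriv (v i) f p)"
  using assms(4,3)
proof (induction I rule: finite_induct)
  case empty
  then show ?case using dir_deriv_scale[OF assms(1,2) vec.subspace_0[OF subspace], of 0] by simp
next
  case (insert i I)
  then have "(\<Sum>i\<in>I. c i *s v i) \<in> E" "c i *s v i \<in> E"
    using subspace by (auto intro!: vec.subspace_sum vec.subspace_scale)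
  then show ?case
    using insert by (simp add: dir_deriv_add[OF assms(1,2)] dir_deriv_scale[OF assms(1,2)])
qed

lemma holo_on_add:
  assumes "holo_on E U f" and "holo_on E U g"
  shows "holo_on E U (\<lambda>p. f p + g p)"
  unfolding holo_on_def
proof
  fix p assume "p \<in> U"
  with assms obtain f' g' where "(f has_derivative f') (at p within U)" "(g has_derivative g') (at p within U)"
    "\<forall>c. \<forall>v\<in>E. f' (c *s v) = c *s f' v" "\<forall>c. \<forall>v\<in>E. g' (c *s v) = c *s g' v"
    unfolding holo_on_def by meson
  then show "\<exists>f'. ((\<lambda>p. f p + g p) has_derivative f') (at p within U) \<and> (\<forall>c. \<forall>v\<in>E. f' (c *s v) = c *s f' v)"
    by (intro exI[of _ "\<lambda>v. f' v + g' v"]) (auto intro!: derivative_eq_intros simp: vec.scale_right_distrib)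
qed

lemma bounded_linear_scale_right: "bounded_linear (\<lambda>x. c *s (x :: complex ^ 'n))"
  by (rule linear_imp_bounded_linear) (simp_all add: vec_eq_iff algebra_simps)

lemma holo_on_scale:
  assumes "holo_on E U f"
  shows "holo_on E U (\<lambda>p. c *s f p)"
  unfolding holo_on_def
proof
  fix p assume "p \<in> U"
  with assms obtain f' where f': "(f has_derivative f') (at p within U)"
    "\<forall>c. \<forall>v\<in>E. f' (c *s v) = c *s f' v"
    unfolding holo_on_def by meson
  from bounded_linear.has_derivative[OF bounded_linear_scale_right f'(1)] f'(2)
  show "\<exists>f'. ((\<lambda>p. c *s f p) has_derivative f') (at p within U) \<and> (\<forall>c. \<forall>v\<in>E. f' (c *s v) = c *s f' v)"
    by (intro exI[of _ "\<lambda>v. c *s f' v"]) (auto simp: mult.commute)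
qed

lemma holo_on_zero: "holo_on E U (\<lambda>p. 0)"
  unfolding holo_on_def by (auto intro!: exI[of _ "\<lambda>v. 0"])

lemma holo_on_combination:
  assumes "\<And>i. i \<in> I \<Longrightarrow> holo_on E U (F i)"
  shows "holo_on E U (\<lambda>p. \<Sum>i\<in>I. c i *s F i p)"
  using assms by (induction I rule: infinite_finite_induct)
    (auto intro!: holo_on_add holo_on_scale holo_on_zero)

lemma dir_deriv_combination:
  assumes "\<And>i. i \<in> I \<Longrightarrow> holo_on E U (F i)" and "p \<in> U" and "v \<in> E"
  shows "dir_deriv v (\<lambda>p. \<Sum>i\<in>I. c i *s F i p) p = (\<Sum>i\<in>I. c i *s dir_deriv v (F i) p)"
proof -
  have "deriv (\<lambda>h. \<Sum>i\<in>I. c i * F i (p + h *s v) $ l) 0 = (\<Sum>i\<in>I. c i * dir_deriv v (F i) p $ l)" for l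
    by (intro DERIV_imp_deriv DERIV_sum DERIV_cmult has_field_derivative_dir_deriv assms)
  then show ?thesis
    by (simp add: vec_eq_iff dir_deriv_def[of v "\<lambda>p. \<Sum>i\<in>I. c i *s F i p"])
qed

lemma dir_deriv_scale_add:
  assumes "holo_on E U f" and "holo_on E U g" and "p \<in> U" and "v \<in> E"
  shows "dir_deriv v (\<lambda>q. c *s f q + g q) p = c *s dir_deriv v f p + dir_deriv v g p"
proof -
  have "dir_deriv v (\<lambda>q. \<Sum>b\<in>{True, False}. (if b then c else 1) *s (if b then f else g) q) p
      = (\<Sum>b\<in>{True, False}. (if b then c else 1) *s dir_deriv v (if b then f else g) p)"
    by (rule dir_deriv_combination) (use assms in auto)
  then show ?thesis by simp
qed

end

section \<open>Iterated directional derivatives and osculating spaces\<close>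

lemma indices_Suc: "indices k (Suc n) = (\<lambda>(m, I). m # I) ` ({1..k} \<times> indices k n)"
  by (auto simp: indices_def length_Suc_conv image_iff)

lemma sum_indices_Suc:
  "(\<Sum>I\<in>indices k (Suc n). f I) = (\<Sum>m=1..k. \<Sum>I\<in>indices k n. f (m # I))"
  unfolding indices_Suc
  by (subst sum.reindex) (auto simp: inj_on_def sum.cartesian_product case_prod_beta intro!: sum.cong)

lemma dir_deriv_power: "(dir_deriv v ^^ n) f = foldr dir_deriv (replicate n v) f"
  by (induction n) auto

context parameter_domain
begin

lemma holo_on_iterated:
  "holo_on E U f \<Longrightarrow> set vs \<subseteq> E \<Longrightarrow> holo_on E U (foldr dir_deriv vs f)"
  by (induction vs) (auto intro: holo_on_dir_deriv)

lemma iterated_pull_front: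
  assumes f: "holo_on E U f" and "set vs \<subseteq> E" and "set ws \<subseteq> E" and "w \<in> E" and "p \<in> U"
  shows "foldr dir_deriv (vs @ w # ws) f p = foldr dir_deriv (w # vs @ ws) f p"
  using assms(2,5)
proof (induction vs arbitrary: p)
  case (Cons v vs)
  have "foldr dir_deriv ((v # vs) @ w # ws) f p = dir_deriv v (foldr dir_deriv (w # vs @ ws) f) p"
    unfolding append_Cons foldr.simps comp_apply
    by (rule dir_deriv_cong[OF Cons.prems(2)]) (use Cons.IH Cons.prems in auto)
  also have "\<dots> = dir_deriv w (dir_deriv v (foldr dir_deriv (vs @ ws) f)) p"
    using dir_deriv_commute[OF holo_on_iterated[OF f, of "vs @ ws"]] Cons.prems assms by simp
  finally show ?case by simp
qed simp

lemma iterated_symmetric: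
  assumes f: "holo_on E U f" and "mset vs = mset ws" and "set vs \<subseteq> E" and "p \<in> U"
  shows "foldr dir_deriv vs f p = foldr dir_deriv ws f p"
  using assms(2-)
proof (induction vs arbitrary: ws p)
  case (Cons v vs)
  then obtain xs ys where ws: "ws = xs @ v # ys"
    by (metis list.set_intros(1) mset_eq_setD split_list)
  have sets: "set xs \<subseteq> E" "set ys \<subseteq> E" "v \<in> E"
    using mset_eq_setD[OF Cons.prems(1)] Cons.prems(2) unfolding ws by auto
  have "mset vs = mset (xs @ ys)"
    using Cons.prems(1) unfolding ws by simp
  then have "foldr dir_deriv vs f q = foldr dir_deriv (xs @ ys) f q" if "q \<in> U" for q
    by (rule Cons.IH) (use Cons.prems(2) that in auto)
  then show ?case
    unfolding ws iterated_pull_front[OF f sets Cons.prems(3)]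
    unfolding foldr.simps comp_apply by (rule dir_deriv_cong[OF Cons.prems(3) sets(3)])
qed simp

text \<open>
  The coefficients \<open>c m\<close> and the directions \<open>e m\<close> are constant, so the expansion of each factor commutes with
  the remaining derivatives.
\<close>

lemma iterated_multilinear:
  assumes f: "holo_on E U f" and e: "\<And>m. m \<in> {1..k} \<Longrightarrow> e m \<in> E" and "p \<in> U"
  shows "foldr dir_deriv (replicate n (\<Sum>m=1..k. c m *s e m)) f p =
    (\<Sum>I\<in>indices k n. (\<Prod>i\<leftarrow>I. c i) *s foldr dir_deriv (map e I) f p)"
  using \<open>p \<in> U\<close>
proof (induction n arbitrary: p)
  case 0
  have "indices k 0 = {[]}" by (auto simp: indices_def)
  then show ?case by simp
next
  case (Suc n)
  let ?v = "\<Sum>m=1..k. c m *s e m"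
  have v: "?v \<in> E"
    by (intro vec.subspace_sum[OF subspace] vec.subspace_scale[OF subspace] e)
  have holo: "holo_on E U (foldr dir_deriv (map e I) f)" if "I \<in> indices k r" for I r
    by (rule holo_on_iterated[OF f]) (use e that in \<open>auto simp: indices_def\<close>)
  have "foldr dir_deriv (replicate (Suc n) ?v) f p = dir_deriv ?v
      (\<lambda>q. \<Sum>I\<in>indices k n. (\<Prod>i\<leftarrow>I. c i) *s foldr dir_deriv (map e I) f q) p"
    unfolding replicate_Suc foldr.simps comp_apply
    by (rule dir_deriv_cong[OF Suc.prems v Suc.IH])
  also have "\<dots> = (\<Sum>I\<in>indices k n. (\<Prod>i\<leftarrow>I. c i) *s dir_deriv ?v (foldr dir_deriv (map e I) f) p)"
    by (rule dir_deriv_combination[OF holo Suc.prems v])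
  also have "\<dots> = (\<Sum>I\<in>indices k n. \<Sum>m=1..k.
      (\<Prod>i\<leftarrow>m # I. c i) *s foldr dir_deriv (map e (m # I)) f p)"
  proof (rule sum.cong[OF refl])
    fix I assume "I \<in> indices k n"
    from dir_deriv_linear_sum[OF holo[OF this] Suc.prems e, of "{1..k}" "\<lambda>m. m" c]
    show "(\<Prod>i\<leftarrow>I. c i) *s dir_deriv ?v (foldr dir_deriv (map e I) f) p = (\<Sum>m=1..k.
      (\<Prod>i\<leftarrow>m # I. c i) *s foldr dir_deriv (map e (m # I)) f p)"
      by (simp add: vec.scale_sum_right mult.commute)
  qed
  also have "\<dots> = (\<Sum>I\<in>indices k (Suc n). (\<Prod>i\<leftarrow>I. c i) *s foldr dir_deriv (map e I) f p)"
    unfolding sum_indices_Suc by (rule sum.swap)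
  finally show ?case .
qed

lemma iterated_mem_osc_space:
  "set vs \<subseteq> E \<Longrightarrow> length vs \<le> s \<Longrightarrow> foldr dir_deriv vs f p \<in> osc_space E f s p"
  unfolding osc_space_def by (rule vec.span_base) blast

lemma osc_space_mono: "s \<le> s' \<Longrightarrow> osc_space E f s p \<subseteq> osc_space E f s' p"
  unfolding osc_space_def by (rule vec.span_mono) (auto intro: order_trans)

text \<open>
  Every vector of an osculating space extends to a section of the osculating bundle whose derivatives
  lie in the next osculating space: extend a combination of iterated derivatives with constant
  coefficients.
\<close>

lemma osculating_section_through:
  assumes f: "holo_on E U f" and p: "p \<in> U" and "x \<in> osc_space E f s p"
  shows "\<exists>G. holo_on E U G \<and> (\<forall>q\<in>U. G q \<in> osc_space E f s q) \<and> G p = x \<and>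
    (\<forall>v\<in>E. dir_deriv v G p \<in> osc_space E f (Suc s) p)"
  using assms(3) unfolding osc_space_def[of E f s p]
proof (induction rule: vec.span_induct_alt)
  case base
  have "dir_deriv v (\<lambda>q. 0) p = 0" for v :: "complex ^ 'n"
    by (simp add: dir_deriv_def vec_eq_iff)
  then show ?case
    by (intro exI[of _ "\<lambda>q. 0"]) (simp add: holo_on_zero osc_space_def vec.span_zero)
next
  case (step c x y)
  then obtain G where G: "holo_on E U G" "\<forall>q\<in>U. G q \<in> osc_space E f s q" "G p = y"
    "\<forall>v\<in>E. dir_deriv v G p \<in> osc_space E f (Suc s) p" by blast
  from step obtain vs where vs: "set vs \<subseteq> E" "length vs \<le> s" "x = foldr dir_deriv vs f p" by blast
  let ?D = "foldr dir_deriv vs f"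
  have D: "holo_on E U ?D" by (rule holo_on_iterated[OF f vs(1)])
  have sub: "vec.subspace (osc_space E f r q)" for r q
    unfolding osc_space_def by (rule vec.subspace_span)
  have "dir_deriv v ?D p \<in> osc_space E f (Suc s) p" if "v \<in> E" for v
    using iterated_mem_osc_space[of "v # vs" "Suc s" f p] vs that by simp
  then show ?case
    using G vs(3) iterated_mem_osc_space[OF vs(1,2)]
    by (intro exI[of _ "\<lambda>q. c *s ?D q + G q"])
      (auto intro!: holo_on_add holo_on_scale D vec.subspace_add[OF sub] vec.subspace_scale[OF sub]
        simp: dir_deriv_scale_add[OF D G(1) p])
qed

lemma linear_dir_deriv_proj:
  "holo_on E U f \<Longrightarrow> p \<in> U \<Longrightarrow> Vector_Spaces.linear (*s) (*s) (\<lambda>x. dir_deriv (proj x) f p)"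
  unfolding Vector_Spaces.linear_iff
  by (auto simp: proj_add proj_scale proj_in dir_deriv_add dir_deriv_scale vec.vector_space_axioms)

lemma subspace_dir_deriv_image:
  assumes "holo_on E U f" and "p \<in> U"
  shows "vec.subspace ((\<lambda>v. dir_deriv v f p) ` E)"
proof -
  have "(\<lambda>v. dir_deriv v f p) ` E = (\<lambda>x. dir_deriv (proj x) f p) ` E"
    by (intro image_cong) (simp_all add: proj_id)
  then show ?thesis
    using vec.linear_subspace_image[OF linear_dir_deriv_proj[OF assms] subspace] by simp
qed

end

section \<open>Moving frames\<close>

locale moving_frame = parameter_domain E U
  for E U :: "(complex ^ 'n::finite) set" +
  fixes N :: nat and A :: "nat \<Rightarrow> complex ^ 'n \<Rightarrow> complex ^ 'n"
  assumes card_index: "CARD('n) = N + 1"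
    and holo_frame: "i \<le> N \<Longrightarrow> holo_on E U (A i)"
    and inj_frame: "p \<in> U \<Longrightarrow> inj_on (\<lambda>i. A i p) {0..N}"
    and independent_frame: "p \<in> U \<Longrightarrow> vec.independent ((\<lambda>i. A i p) ` {0..N})"
    and span_frame: "p \<in> U \<Longrightarrow> vec.span ((\<lambda>i. A i p) ` {0..N}) = UNIV"
begin

definition coord :: "complex ^ 'n \<Rightarrow> nat \<Rightarrow> complex ^ 'n \<Rightarrow> complex" where
  "coord p j x = vec.representation ((\<lambda>i. A i p) ` {0..N}) x (A j p)"

abbreviation flag :: "nat \<Rightarrow> complex ^ 'n \<Rightarrow> (complex ^ 'n) set" where
  "flag m p \<equiv> vec.span ((\<lambda>i. A i p) ` {0..m})"

lemma coord_expand: "p \<in> U \<Longrightarrow> (\<Sum>i=0..N. coord p i x *s A i p) = x"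
  using vec.sum_representation_eq[OF independent_frame, of p x "(\<lambda>i. A i p) ` {0..N}"]
  by (simp add: span_frame sum.reindex[OF inj_frame] coord_def)

lemma coord_add: "p \<in> U \<Longrightarrow> coord p j (x + y) = coord p j x + coord p j y"
  and coord_scale: "p \<in> U \<Longrightarrow> coord p j (c *s x) = c * coord p j x"
  and coord_sum: "p \<in> U \<Longrightarrow> coord p j (\<Sum>a\<in>I. f a) = (\<Sum>a\<in>I. coord p j (f a))"
  by (simp_all add: coord_def span_frame independent_frame vec.representation_add
      vec.representation_scale vec.representation_sum)

lemma coord_zero: "p \<in> U \<Longrightarrow> coord p j 0 = 0"
  using coord_scale[of p j 0 0] by simp

lemma coord_diff: "p \<in> U \<Longrightarrow> coord p j (x - y) = coord p j x - coord p j y"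
  using coord_add[of p j "x - y" y] by simp

lemma coord_frame:
  "p \<in> U \<Longrightarrow> i \<le> N \<Longrightarrow> j \<le> N \<Longrightarrow> coord p j (A i p) = (if i = j then 1 else 0)"
  using inj_onD[OF inj_frame, of p j i]
  by (auto simp: coord_def vec.representation_basis[OF independent_frame])

lemma coord_combination:
  assumes "p \<in> U" and "m \<le> N" and "j \<le> N"
  shows "coord p j (\<Sum>i=0..m. c i *s A i p) = (if j \<le> m then c j else 0)"
proof -
  have "coord p j (\<Sum>i=0..m. c i *s A i p) = (\<Sum>i=0..m. if i = j then c i else 0)"
    unfolding coord_sum[OF assms(1)] coord_scale[OF assms(1)]
    by (intro sum.cong) (use assms coord_frame in auto)
  then show ?thesis by simp
qed

lemma mem_flag_iff:
  assumes p: "p \<in> U" and "m \<le> N"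
  shows "x \<in> flag m p \<longleftrightarrow> (\<forall>j\<in>{m<..N}. coord p j x = 0)"
proof
  assume "x \<in> flag m p"
  then show "\<forall>j\<in>{m<..N}. coord p j x = 0"
    by (rule vec.span_induct)
      (use assms in \<open>auto simp: vec.subspace_def coord_add coord_scale coord_zero coord_frame\<close>)
next
  assume *: "\<forall>j\<in>{m<..N}. coord p j x = 0"
  have "(\<Sum>i=0..N. coord p i x *s A i p) \<in> flag m p"
  proof (rule vec.span_sum)
    fix i assume "i \<in> {0..N}"
    with * show "coord p i x *s A i p \<in> flag m p"
      by (cases "i \<le> m") (auto intro: vec.span_scale[OF vec.span_base] simp: vec.span_zero)
  qed
  then show "x \<in> flag m p" by (simp add: coord_expand[OF p])
qed

lemma dim_flag:
  assumes p: "p \<in> U" and "m \<le> N"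
  shows "vec.dim (flag m p) = m + 1"
proof -
  have sub: "{0..m} \<subseteq> {0..N}" using assms by auto
  have "vec.independent ((\<lambda>i. A i p) ` {0..m})"
    by (rule vec.independent_mono[OF independent_frame[OF p]]) (use sub in blast)
  moreover have "card ((\<lambda>i. A i p) ` {0..m}) = m + 1"
    using card_image[OF inj_on_subset[OF inj_frame[OF p] sub]] by simp
  ultimately show ?thesis
    by (simp add: vec.dim_span_eq_card_independent del: vec.dim_span)
qed

text \<open>
  Rows of square matrices are indexed by the type \<open>'n\<close>, whereas the frame is indexed by \<open>0, \<dots>, N\<close>; the
  bijection \<open>position\<close> translates between the two.
\<close>

definition position :: "'n \<Rightarrow> nat" where
  "position = (SOME \<beta>. bij_betw \<beta> UNIV {0..N})"

lemma bij_position: "bij_betw position UNIV {0..N}"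
proof -
  have "\<exists>\<beta>. bij_betw \<beta> (UNIV :: 'n set) {0..N}"
    using card_index by (intro finite_same_card_bij) auto
  from someI_ex[OF this] show ?thesis unfolding position_def .
qed

lemma position_le: "position i \<le> N"
  using bij_betwE[OF bij_position] by auto

lemma sum_position: "(\<Sum>i\<in>UNIV. f (position i)) = (\<Sum>j=0..N. f j)"
  by (rule sum.reindex_bij_betw[OF bij_position])

definition replaced_row :: "complex ^ 'n \<Rightarrow> nat \<Rightarrow> complex ^ 'n \<Rightarrow> complex ^ 'n ^ 'n" where
  "replaced_row p j y = (\<chi> i. if position i = j then y else A (position i) p)"

lemma row_lambda: "row i (\<chi> i. f i) = f i"
  by (simp add: row_def vec_eq_iff)

text \<open>
  Cramer's rule: up to the nonzero determinant of the frame, the \<open>A j\<close>-component of \<open>y\<close> is a determinant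
  and thus depends continuously on \<open>y\<close> and on the frame.
\<close>

lemma det_replaced_row:
  assumes p: "p \<in> U" and j: "j \<le> N"
  shows "det (replaced_row p j y) = coord p j y * det (\<chi> i. A (position i) p)"
proof -
  obtain k where k: "position k = j"
    using bij_position j by (metis atLeastAtMost_iff bij_betw_iff_bijections zero_le)
  have inj: "position i = j \<longleftrightarrow> i = k" for i
    using bij_position k by (auto simp: bij_betw_def inj_on_def)
  define x where "x = (\<chi> i. coord p (position i) y)"
  have y: "(\<Sum>i\<in>UNIV. x $ i *s row i (\<chi> i. A (position i) p)) = y"
    unfolding x_def using sum_position[of "\<lambda>j. coord p j y *s A j p"]
    by (simp add: row_lambda coord_expand[OF p])
  show ?thesis
    using cramer_lemma_transpose[of k x "\<chi> i. A (position i) p"]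
    unfolding y replaced_row_def by (simp add: x_def row_lambda inj k cong: if_cong)
qed

lemma det_frame:
  assumes p: "p \<in> U"
  shows "det (\<chi> i. A (position i) p) \<noteq> 0"
proof -
  have "c i = 0" if "(\<Sum>i\<in>UNIV. c i *s row i (\<chi> i. A (position i) p)) = 0" for c i
  proof -
    define c' where "c' j = c (inv position j)" for j
    have c: "c i = c' (position i)" for i
      using bij_position by (simp add: c'_def bij_betw_def)
    have "(\<Sum>j=0..N. c' j *s A j p) = 0"
      using that sum_position[of "\<lambda>j. c' j *s A j p"] by (simp add: row_lambda c)
    then show "c i = 0"
      using coord_combination[OF p order_refl position_le, of i c'] position_le[of i]
      by (simp add: c coord_zero[OF p])
  qed
  then show ?thesis
    by (auto simp: invertible_det_nz[symmetric] invertible_right_inverse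
        matrix_right_invertible_independent_rows)
qed

lemma tendsto_det:
  fixes M :: "'b \<Rightarrow> complex ^ 'm ^ 'm::finite"
  assumes "\<And>i l. ((\<lambda>h. M h $ i $ l) \<longlongrightarrow> L $ i $ l) F"
  shows "((\<lambda>h. det (M h)) \<longlongrightarrow> det L) F"
  unfolding det_def by (intro tendsto_intros assms)

text \<open>
  Where a section vanishes, its derivative is the limit of \<open>F (p + h *s v) / h\<close>, which lies in the span of
  \<open>A 0, \<dots>, A m\<close> at \<open>p + h *s v\<close>. The components beyond \<open>m\<close> are determinants that vanish for small \<open>h\<close>, hence
  also in the limit.
\<close>

lemma derivative_vanishing_section:
  assumes F: "holo_on E U F" and sec: "\<And>q. q \<in> U \<Longrightarrow> F q \<in> flag m q" and "m \<le> N"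
    and p: "p \<in> U" and v: "v \<in> E" and "F p = 0"
  shows "dir_deriv v F p \<in> flag m p"
  unfolding mem_flag_iff[OF p \<open>m \<le> N\<close>]
proof
  fix j assume j: "j \<in> {m<..N}"
  let ?M = "\<lambda>h. replaced_row (p + h *s v) j (inverse h *s F (p + h *s v))"
  have "((\<lambda>h. det (?M h)) \<longlongrightarrow> det (replaced_row p j (dir_deriv v F p))) (at 0)"
  proof (rule tendsto_det)
    fix i l
    have "((\<lambda>h. inverse h * F (p + h *s v) $ l) \<longlongrightarrow> dir_deriv v F p $ l) (at 0)"
      using has_field_derivative_dir_deriv[OF F p v, of l] \<open>F p = 0\<close>
      by (simp add: has_field_derivative_iff divide_inverse mult.commute)
    moreover have "((\<lambda>h. A (position i) (p + h *s v) $ l) \<longlongrightarrow> A (position i) p $ l) (at 0)"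
      using DERIV_isCont[OF has_field_derivative_dir_deriv[OF holo_frame[OF position_le] p v]]
      by (simp add: isCont_def)
    ultimately show "((\<lambda>h. ?M h $ i $ l) \<longlongrightarrow> replaced_row p j (dir_deriv v F p) $ i $ l) (at 0)"
      by (cases "position i = j") (simp_all add: replaced_row_def)
  qed
  moreover have "eventually (\<lambda>h. det (?M h) = 0) (at 0)"
  proof -
    have "det (?M h) = 0" if q: "p + h *s v \<in> U" for h
      using sec[OF q] j mem_flag_iff[OF q \<open>m \<le> N\<close>]
      by (simp add: det_replaced_row[OF q] coord_scale[OF q])
    then show ?thesis
      using line_mem[OF p v] by (auto simp: eventually_at_filter elim: eventually_mono)
  qed
  ultimately have "det (replaced_row p j (dir_deriv v F p)) = 0"
    by (rule tendsto_unique[OF trivial_limit_at _ tendsto_eventually])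
  then show "coord p j (dir_deriv v F p) = 0"
    using j det_frame[OF p] by (simp add: det_replaced_row[OF p])
qed

text \<open>
  The product rule for \<open>F = \<Sum> c\<^sub>i A\<^sub>i\<close>, read in the components beyond \<open>m\<close>, where the terms containing a
  derivative of \<open>c\<^sub>i\<close> do not appear. Subtracting from \<open>F\<close> the combination \<open>H\<close> with the constant
  coefficients \<open>c\<^sub>i(p)\<close> reduces this to a section that vanishes at \<open>p\<close>.
\<close>

theorem coord_derivative_section:
  assumes F: "holo_on E U F" and sec: "\<And>q. q \<in> U \<Longrightarrow> F q \<in> flag m q" and m: "m \<le> N"
    and p: "p \<in> U" and v: "v \<in> E" and j: "j \<in> {m<..N}"
  shows "coord p j (dir_deriv v F p) =
    (\<Sum>i=0..m. coord p i (F p) * coord p j (dir_deriv v (A i) p))"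
proof -
  define c where "c i = coord p i (F p)" for i
  define H where "H q = (\<Sum>i=0..m. c i *s A i q)" for q
  define G where "G q = (-1) *s H q + F q" for q
  have hA: "holo_on E U (A i)" if "i \<in> {0..m}" for i
    using holo_frame that m by auto
  have H: "holo_on E U H"
    unfolding H_def by (rule holo_on_combination[OF hA])
  then have G: "holo_on E U G"
    unfolding G_def by (intro holo_on_add holo_on_scale F)
  have flagH: "H q \<in> flag m q" for q
    unfolding H_def by (intro vec.span_sum vec.span_scale vec.span_base imageI)
  have Hp: "H p = F p"
  proof -
    have "c i = 0" if "i \<in> {0..N} - {0..m}" for i
      using sec[OF p] that by (auto simp: mem_flag_iff[OF p m] c_def)
    then have "H p = (\<Sum>i=0..N. c i *s A i p)"
      unfolding H_def using m by (intro sum.mono_neutral_left) auto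
    then show ?thesis by (simp add: c_def coord_expand[OF p])
  qed
  have "dir_deriv v G p \<in> flag m p"
    by (rule derivative_vanishing_section[OF G _ m p v])
      (auto simp: G_def Hp vec_eq_iff intro!: vec.span_diff sec flagH)
  moreover have "dir_deriv v G p = dir_deriv v F p - dir_deriv v H p"
    unfolding G_def[abs_def] dir_deriv_scale_add[OF H F p v] by simp
  ultimately have "coord p j (dir_deriv v F p) = coord p j (dir_deriv v H p)"
    using j by (auto simp: mem_flag_iff[OF p m] coord_diff[OF p])
  also have "dir_deriv v H p = (\<Sum>i=0..m. c i *s dir_deriv v (A i) p)"
    unfolding H_def[abs_def] by (rule dir_deriv_combination[OF hA p v])
  finally show ?thesis
    by (simp add: coord_sum[OF p] coord_scale[OF p] c_def)
qed

end

section \<open>Frames adapted to the osculating spaces\<close>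

text \<open>
  The dimensions \<open>d s\<close> are projective, so the flag at \<open>d s\<close> is spanned by \<open>d s + 1\<close> vectors. The bound
  \<open>d s \<le> N\<close> guarantees that these are frame vectors.
\<close>

locale osculating_frame = moving_frame E U N A
  for E U :: "(complex ^ 'n::finite) set" and N :: nat and A :: "nat \<Rightarrow> complex ^ 'n \<Rightarrow> complex ^ 'n" +
  fixes k t :: nat and d :: "nat \<Rightarrow> nat"
  assumes dim_domain: "vec.dim E = k"
    and immersion: "p \<in> U \<Longrightarrow> v \<in> E \<Longrightarrow> v \<noteq> 0 \<Longrightarrow> dir_deriv v (A 0) p \<notin> vec.span {A 0 p}"
    and flag_tangent: "p \<in> U \<Longrightarrow> flag k p = osc_space E (A 0) 1 p"
    and t_pos: "t \<ge> 1" and d_0: "d 0 = 0" and d_le: "s \<in> {1..t} \<Longrightarrow> d s \<le> N"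
    and flag_osc: "s \<in> {1..t} \<Longrightarrow> p \<in> U \<Longrightarrow> flag (d s) p = osc_space E (A 0) s p"
begin

abbreviation D where
  "D vs \<equiv> foldr dir_deriv vs (A 0)"

abbreviation osc where
  "osc \<equiv> osc_space E (A 0)"

lemma holo_A0: "holo_on E U (A 0)"
  by (rule holo_frame) simp

text \<open>
  With \<open>d 0 = 0\<close> the adaptation of the frame extends to order zero, where the osculating space is the line
  of \<open>A 0\<close>; the case \<open>s = 1\<close> of the relations is then no exception.
\<close>

lemma flag_d: "s \<le> t \<Longrightarrow> p \<in> U \<Longrightarrow> flag (d s) p = osc s p"
proof (cases "s = 0")
  case True
  have "{foldr dir_deriv vs (A 0) p | vs. set vs \<subseteq> E \<and> length vs \<le> 0} = {A 0 p}" by auto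
  then show ?thesis using True by (simp add: osc_space_def d_0)
qed (use flag_osc in auto)

lemma d_bound: "s \<le> t \<Longrightarrow> d s \<le> N"
  using d_le[of s] d_0 by (cases "s = 0") auto

lemma d_mono:
  assumes "s < t" and "p \<in> U"
  shows "d s \<le> d (Suc s)"
proof -
  have "vec.dim (osc s p) \<le> vec.dim (osc (Suc s) p)"
    by (rule vec.dim_subset) (rule osc_space_mono, simp)
  then show ?thesis
    using assms flag_d[of s p] flag_d[of "Suc s" p] dim_flag[of p "d s"] dim_flag[of p "d (Suc s)"]
      d_bound[of s] d_bound[of "Suc s"] by simp
qed

text \<open>
  The derivatives of \<open>A 0\<close> depend injectively on the direction, and \<open>A 0 p\<close> is not among them: both
  are what the immersion property says.
\<close>

lemma tangent_span:
  assumes p: "p \<in> U"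
  shows "vec.dim (insert (A 0 p) ((\<lambda>v. dir_deriv v (A 0) p) ` E)) = k + 1"
proof -
  define \<phi> where "\<phi> x = dir_deriv (proj x) (A 0) p" for x
  have lin: "Vector_Spaces.linear (*s) (*s) \<phi>"
    unfolding \<phi>_def by (rule linear_dir_deriv_proj[OF holo_A0 p])
  have im: "(\<lambda>v. dir_deriv v (A 0) p) ` E = \<phi> ` E"
    by (auto simp: \<phi>_def proj_id)
  have span_E: "vec.span E = E"
    using subspace by simp
  have not_0: "\<phi> v \<notin> vec.span {A 0 p}" if "v \<in> E" "v \<noteq> 0" for v
    using immersion[OF p that] that by (simp add: \<phi>_def proj_id)
  have inj: "inj_on \<phi> E"
  proof (rule inj_onI)
    fix x y assume xy: "x \<in> E" "y \<in> E" "\<phi> x = \<phi> y"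
    then have "\<phi> (x - y) = 0"
      using vec.linear_diff[OF lin, of x y] by simp
    then show "x = y"
      using not_0[of "x - y"] vec.subspace_diff[OF subspace xy(1,2)] vec.span_zero by fastforce
  qed
  have dim: "vec.dim (\<phi> ` E) = k"
    using vec.dim_image_eq[OF lin, of E] inj span_E dim_domain by simp
  have "A 0 p \<notin> \<phi> ` E"
  proof
    assume "A 0 p \<in> \<phi> ` E"
    then obtain v where v: "v \<in> E" "\<phi> v = A 0 p" by auto
    then have "v = 0" using not_0[of v] by (auto intro: vec.span_base)
    then have "A 0 p = 0" using v(2) vec.linear_0[OF lin] by simp
    then show False using coord_frame[OF p, of 0 0] coord_zero[OF p] by simp
  qed
  then have "A 0 p \<notin> vec.span (\<phi> ` E)"
    using vec.span_eq_iff[THEN iffD2, OF vec.linear_subspace_image[OF lin subspace]] by metis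
  then show ?thesis
    unfolding im by (simp add: vec.dim_insert dim)
qed

lemma k_le:
  assumes "p \<in> U"
  shows "k \<le> N"
  using dim_subset_UNIV_cart_gen[of "insert (A 0 p) ((\<lambda>v. dir_deriv v (A 0) p) ` E)"]
  by (simp add: tangent_span[OF assms] card_index)

lemma d_1:
  assumes p: "p \<in> U"
  shows "d 1 = k"
proof -
  have "flag (d 1) p = flag k p"
    using flag_tangent[OF p] flag_osc[of 1 p] t_pos p by simp
  then show ?thesis
    using dim_flag[OF p k_le[OF p]] dim_flag[OF p d_bound[OF t_pos]] by simp
qed

text \<open>
  The vectors of an osculating space move only within the next one. The vector \<open>A i p\<close> extends to a section \<open>G\<close> of the \<open>s\<close>-th osculating
  bundle whose derivative lies in the next osculating space. By \<open>coord_derivative_section\<close> the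
  components beyond \<open>d s\<close> of this derivative depend only on the value \<open>G p = A i p\<close>, so they agree with those of
  the derivative of \<open>A i\<close>.
\<close>

lemma coord_derivative_frame_eq_0:
  assumes s: "s < t" and p: "p \<in> U" and v: "v \<in> E" and i: "i \<le> d s" and j: "j \<in> {d (Suc s)<..N}"
  shows "coord p j (dir_deriv v (A i) p) = 0"
proof -
  have ds: "d s \<le> N" "d (Suc s) \<le> N" "d s \<le> d (Suc s)"
    using d_bound s d_mono[OF s p] by auto
  have "A i p \<in> flag (d s) p"
    using i by (intro vec.span_base imageI) simp
  then have "A i p \<in> osc s p"
    using flag_d[of s p] s p by simp
  then obtain G where G: "holo_on E U G" "\<forall>q\<in>U. G q \<in> osc s q" "G p = A i p"
    "dir_deriv v G p \<in> osc (Suc s) p"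
    using osculating_section_through[OF holo_A0 p] v by blast
  have "coord p j (dir_deriv v G p) = 
      (\<Sum>l=0..d s. coord p l (A i p) * coord p j (dir_deriv v (A l) p))"
    using coord_derivative_section[OF G(1) _ ds(1) p v, of j] G(2,3) flag_d[of s] s j ds by simp
  also have "\<dots> = (\<Sum>l=0..d s. if l = i then coord p j (dir_deriv v (A l) p) else 0)"
    by (intro sum.cong) (use i ds coord_frame[OF p] in auto)
  also have "\<dots> = coord p j (dir_deriv v (A i) p)"
    using i by simp
  finally show ?thesis
    using G(4) flag_d[of "Suc s" p] s p j mem_flag_iff[OF p ds(2)] by simp
qed

theorem coord_next_derivative:
  assumes s: "s \<in> {1..t}" and vs: "set vs \<subseteq> E" "length vs = s" and p: "p \<in> U" and v: "v \<in> E"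
    and j: "j \<in> {d s<..N}"
  shows "coord p j (D (v # vs) p) =
    (\<Sum>i=d (s - 1) + 1..d s. coord p i (D vs p) * coord p j (dir_deriv v (A i) p))"
proof -
  have s': "s - 1 < t" "Suc (s - 1) = s" "s \<le> t" using s by auto
  have "coord p j (D (v # vs) p) =
      (\<Sum>i=0..d s. coord p i (D vs p) * coord p j (dir_deriv v (A i) p))"
    using coord_derivative_section[OF holo_on_iterated[OF holo_A0 vs(1)] _ d_bound[OF s'(3)] p v j]
      flag_d[OF s'(3)] iterated_mem_osc_space[OF vs(1), of s] vs(2) by simp
  also have "\<dots> = (\<Sum>i=d (s - 1) + 1..d s. coord p i (D vs p) * coord p j (dir_deriv v (A i) p))"
    using coord_derivative_frame_eq_0[OF s'(1) p v, unfolded s'(2), OF _ j]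
    by (intro sum.mono_neutral_right) (auto simp: not_less_eq_eq)
  finally show ?thesis .
qed

lemma span_tangent_vectors:
  assumes p: "p \<in> U"
  shows "vec.span (insert (A 0 p) ((\<lambda>v. dir_deriv v (A 0) p) ` E)) = flag k p"
proof (rule vec.subspace_dim_equal)
  have "insert (A 0 p) ((\<lambda>v. dir_deriv v (A 0) p) ` E) \<subseteq> osc 1 p"
    using iterated_mem_osc_space[of "[]" 1 "A 0" p] iterated_mem_osc_space[of "[v]" 1 "A 0" p for v]
    by auto
  then show "vec.span (insert (A 0 p) ((\<lambda>v. dir_deriv v (A 0) p) ` E)) \<subseteq> flag k p"
    unfolding flag_tangent[OF p]
    by (intro vec.span_minimal) (auto simp: osc_space_def)
qed (simp_all only: vec.subspace_span vec.dim_span tangent_span[OF p]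
    dim_flag[OF p k_le[OF p], unfolded vec.dim_span])

text \<open>
  The forms \<open>\<omega> 1, \<dots>, \<omega> k\<close> are linear coordinates on \<open>E\<close>. The derivatives of \<open>A 0\<close> together with \<open>A 0\<close> itself
  fill the tangent flag, so each \<open>A m\<close> is such a derivative modulo \<open>A 0\<close>; this gives the dual vectors. A
  direction is determined by its coordinates because of the immersion property.
\<close>

lemma dual_vectors:
  assumes p: "p \<in> U"
  shows "\<exists>e. (\<forall>m\<in>{1..k}. e m \<in> E \<and> (\<forall>i\<in>{1..k}. coord p i (dir_deriv (e m) (A 0) p) = (if i = m then 1 else 0))) \<and>
    (\<forall>v\<in>E. v = (\<Sum>m=1..k. coord p m (dir_deriv v (A 0) p) *s e m))"
proof -
  let ?w = "\<lambda>i v. coord p i (dir_deriv v (A 0) p)"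
  note k = k_le[OF p]
  have A0: "coord p i (c *s A 0 p) = 0" if "i \<in> {1..k}" for i c
    using coord_frame[OF p, of 0 i] that k by (simp add: coord_scale[OF p])
  have "\<exists>e\<in>E. \<forall>i\<in>{1..k}. ?w i e = (if i = m then 1 else 0)" if m: "m \<in> {1..k}" for m
  proof -
    have "A m p \<in> flag k p"
      using m by (intro vec.span_base) auto
    then obtain c where "A m p - c *s A 0 p \<in> vec.span ((\<lambda>v. dir_deriv v (A 0) p) ` E)"
      unfolding span_tangent_vectors[OF p, symmetric] vec.span_insert by blast
    then obtain e where e: "e \<in> E" "dir_deriv e (A 0) p = A m p - c *s A 0 p"
      unfolding vec.span_eq_iff[THEN iffD2, OF subspace_dir_deriv_image[OF holo_A0 p]] by auto
    have "?w i e = (if i = m then 1 else 0)" if "i \<in> {1..k}" for i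
      using m that k coord_frame[OF p, of m i] by (simp add: e(2) coord_diff[OF p] A0[OF that])
    then show ?thesis using e(1) by blast
  qed
  then obtain e where e: "\<And>m. m \<in> {1..k} \<Longrightarrow> e m \<in> E"
    "\<And>m i. m \<in> {1..k} \<Longrightarrow> i \<in> {1..k} \<Longrightarrow> ?w i (e m) = (if i = m then 1 else 0)"
    by metis
  have "v = (\<Sum>m=1..k. ?w m v *s e m)" if v: "v \<in> E" for v
  proof -
    define u where "u = (\<Sum>m=1..k. ?w m v *s e m)"
    have u: "u \<in> E"
      unfolding u_def by (intro vec.subspace_sum[OF subspace] vec.subspace_scale[OF subspace] e)
    have eq: "dir_deriv (v - u) (A 0) p = dir_deriv v (A 0) p - dir_deriv u (A 0) p"
      using dir_deriv_add[OF holo_A0 p vec.subspace_diff[OF subspace v u] u] by simp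
    have "?w i u = ?w i v" if i: "i \<in> {1..k}" for i
    proof -
      have "?w i u = (\<Sum>m=1..k. ?w m v * ?w i (e m))"
        unfolding u_def
        by (subst dir_deriv_linear_sum[OF holo_A0 p e(1)]) (simp_all add: coord_sum[OF p] coord_scale[OF p])
      also have "\<dots> = (\<Sum>m=1..k. if m = i then ?w m v else 0)"
        by (intro sum.cong) (use i e(2) in auto)
      finally show ?thesis using i by simp
    qed
    then have "?w i (v - u) = 0" if "i \<in> {1..k}" for i
      using that by (simp add: eq coord_diff[OF p])
    moreover have "dir_deriv (v - u) (A 0) p \<in> flag k p"
      unfolding span_tangent_vectors[OF p, symmetric]
      by (intro vec.span_base) (use vec.subspace_diff[OF subspace v u] in auto)
    ultimately have "?w i (v - u) = 0" if "i \<in> {0<..N}" for i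
      using that by (cases "i \<le> k") (auto simp: mem_flag_iff[OF p k])
    then have "dir_deriv (v - u) (A 0) p \<in> flag 0 p"
      unfolding mem_flag_iff[OF p le0] by blast
    then show ?thesis
      using immersion[OF p vec.subspace_diff[OF subspace v u]] by (auto simp: u_def)
  qed
  then show ?thesis using e by (intro exI[of _ e]) auto
qed

text \<open>
  The coefficients are components of the derivatives of \<open>A 0\<close> along vectors \<open>e p m\<close> dual to the forms at
  \<open>p\<close>. These vectors vary with \<open>p\<close>, but the derivatives at \<open>p\<close> are taken along the constant directions
  \<open>e p m\<close>, so no derivative of \<open>e\<close> enters.
\<close>

theorem fundamental_forms:
  assumes forms: "frame_forms N k E U A \<omega> \<Omega>"
  shows "\<exists>q :: complex ^ 'n \<Rightarrow> nat list \<Rightarrow> nat \<Rightarrow> complex. \<forall>p\<in>U. \<forall>s\<in>{1..t}.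
       fund_form_given_by N (d s) E A (s + 1) p
         (\<lambda>j v. \<Sum>I\<in>indices k (s + 1). q p I j * (\<Prod>i\<leftarrow>I. \<omega> i p v)) \<and>
       (\<forall>I\<in>indices k (s + 1). \<forall>J\<in>indices k (s + 1). \<forall>j\<in>{d s + 1..N}.
          mset I = mset J \<longrightarrow> q p I j = q p J j) \<and>
       (s = 1 \<longrightarrow> (\<forall>i\<in>{1..k}. \<forall>j\<in>{d 1 + 1..N}. \<forall>v\<in>E.
          \<Omega> i j p v = (\<Sum>m=1..k. q p [i, m] j * \<omega> m p v))) \<and>
       (s \<ge> 2 \<longrightarrow> (\<forall>I\<in>indices k s. \<forall>j\<in>{d s + 1..N}. \<forall>v\<in>E.
          (\<Sum>i=d (s - 1) + 1..d s. q p I i * \<Omega> i j p v) =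
          (\<Sum>m=1..k. q p (I @ [m]) j * \<omega> m p v)))"
proof -
  have \<omega>: "coord p m (dir_deriv v (A 0) p) = \<omega> m p v" if "p \<in> U" "v \<in> E" "m \<in> {1..k}" for p v m
    using forms that k_le[OF that(1)] unfolding frame_forms_def
    by (simp add: coord_combination)
  have \<Omega>: "coord p j (dir_deriv v (A i) p) = \<Omega> i j p v"
    if "p \<in> U" "v \<in> E" "i \<in> {1..N}" "j \<le> N" for p v i j
    using forms that unfolding frame_forms_def by (simp add: coord_combination)
  define dual where "dual p e \<longleftrightarrow>
    (\<forall>m\<in>{1..k}. e m \<in> E \<and> (\<forall>i\<in>{1..k}. \<omega> i p (e m) = (if i = m then 1 else 0))) \<and>
    (\<forall>v\<in>E. (\<Sum>m=1..k. \<omega> m p v *s e m) = v)" for p e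
  have "\<exists>e. dual p e" if p: "p \<in> U" for p
  proof -
    obtain e where e: "\<And>m. m \<in> {1..k} \<Longrightarrow> e m \<in> E"
      "\<And>m i. m \<in> {1..k} \<Longrightarrow> i \<in> {1..k} \<Longrightarrow> coord p i (dir_deriv (e m) (A 0) p) = (if i = m then 1 else 0)"
      "\<And>v. v \<in> E \<Longrightarrow> v = (\<Sum>m=1..k. coord p m (dir_deriv v (A 0) p) *s e m)"
      using dual_vectors[OF p] by blast
    have "(\<Sum>m=1..k. \<omega> m p v *s e m) = v" if "v \<in> E" for v
      using e(3)[OF that] by (simp add: \<omega>[OF p that])
    moreover have "\<omega> i p (e m) = (if i = m then 1 else 0)" if "m \<in> {1..k}" "i \<in> {1..k}" for i m
      using e(2)[OF that] \<omega>[OF p e(1)[OF that(1)] that(2)] by simp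
    ultimately show ?thesis
      using e(1) unfolding dual_def by blast
  qed
  then obtain e where "\<forall>p\<in>U. dual p (e p)"
    using bchoice[of U dual] by blast
  then have e: "\<And>p m. p \<in> U \<Longrightarrow> m \<in> {1..k} \<Longrightarrow> e p m \<in> E"
    "\<And>p i m. p \<in> U \<Longrightarrow> m \<in> {1..k} \<Longrightarrow> i \<in> {1..k} \<Longrightarrow> \<omega> i p (e p m) = (if i = m then 1 else 0)"
    "\<And>p v. p \<in> U \<Longrightarrow> v \<in> E \<Longrightarrow> (\<Sum>m=1..k. \<omega> m p v *s e p m) = v"
    unfolding dual_def by blast+
  define q where "q p I j = coord p j (D (map (e p) I) p)" for p I j
  have sets: "set (map (e p) I) \<subseteq> E" if "p \<in> U" "I \<in> indices k r" for p I r
    using e(1) that by (auto simp: indices_def)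
  have sym: "q p I j = q p J j" if "p \<in> U" "I \<in> indices k r" "mset I = mset J" for p I J j r
    unfolding q_def using iterated_symmetric[OF holo_A0 _ sets[OF that(1,2)] that(1), of "map (e p) J"] that(3)
    by simp
  have rel: "(\<Sum>i=d (s - 1) + 1..d s. q p I i * \<Omega> i j p v) = (\<Sum>m=1..k. q p (I @ [m]) j * \<omega> m p v)"
    if p: "p \<in> U" and s: "s \<in> {1..t}" and I: "I \<in> indices k s" and j: "j \<in> {d s + 1..N}" and v: "v \<in> E"
    for p s I j v
  proof -
    let ?vs = "map (e p) I"
    have "(\<Sum>i=d (s - 1) + 1..d s. q p I i * \<Omega> i j p v)
        = (\<Sum>i=d (s - 1) + 1..d s. coord p i (D ?vs p) * coord p j (dir_deriv v (A i) p))"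
      unfolding q_def using j by (intro sum.cong refl arg_cong2[where f = "(*)"] \<Omega>[OF p v, symmetric]) auto
    also have "\<dots> = coord p j (dir_deriv v (D ?vs) p)"
      using coord_next_derivative[OF s sets[OF p I] _ p v, of j] I j by (simp add: indices_def)
    also have "dir_deriv v (D ?vs) p = (\<Sum>m=1..k. \<omega> m p v *s dir_deriv (e p m) (D ?vs) p)"
      using dir_deriv_linear_sum[OF holo_on_iterated[OF holo_A0 sets[OF p I]] p e(1)[OF p],
          where c = "\<lambda>m. \<omega> m p v" and I = "{1..k}", of "\<lambda>m. m"]
      by (simp only: e(3)[OF p v] finite_atLeastAtMost simp_thms)
    also have "coord p j \<dots> = (\<Sum>m=1..k. q p (m # I) j * \<omega> m p v)"
      by (simp add: coord_sum[OF p] coord_scale[OF p] q_def mult.commute)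
    also have "\<dots> = (\<Sum>m=1..k. q p (I @ [m]) j * \<omega> m p v)"
    proof (rule sum.cong[OF refl])
      fix m assume "m \<in> {1..k}"
      then have "m # I \<in> indices k (Suc s)" using I by (simp add: indices_def)
      from sym[OF p this, of "I @ [m]" j] show "q p (m # I) j * \<omega> m p v = q p (I @ [m]) j * \<omega> m p v"
        by simp
    qed
    finally show ?thesis .
  qed
  \<comment> \<open>The vectors \<open>e p i\<close> are dual to the forms, so \<open>q p [i] l\<close> is a Kronecker symbol and the general
    relation at \<open>I = [i]\<close> reduces to a formula for \<open>\<Omega> i j\<close>.\<close>
  have rel_1: "\<Omega> i j p v = (\<Sum>m=1..k. q p [i, m] j * \<omega> m p v)"
    if p: "p \<in> U" and i: "i \<in> {1..k}" and j: "j \<in> {d 1 + 1..N}" and v: "v \<in> E" for p i j v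
  proof -
    have "(\<Sum>l=1..k. q p [i] l * \<Omega> l j p v) = (\<Sum>l=1..k. if l = i then \<Omega> l j p v else 0)"
      by (intro sum.cong refl) (use e(2)[OF p i] \<omega>[OF p e(1)[OF p i]] in \<open>simp add: q_def\<close>)
    then have "\<Omega> i j p v = (\<Sum>l=d (1 - 1) + 1..d 1. q p [i] l * \<Omega> l j p v)"
      using i by (simp add: d_0 d_1[OF p, simplified])
    also have "\<dots> = (\<Sum>m=1..k. q p ([i] @ [m]) j * \<omega> m p v)"
      by (rule rel[OF p _ _ j v]) (use i t_pos in \<open>auto simp: indices_def\<close>)
    finally show ?thesis by simp
  qed
  have form: "fund_form_given_by N (d s) E A (s + 1) p
      (\<lambda>j v. \<Sum>I\<in>indices k (s + 1). q p I j * (\<Prod>i\<leftarrow>I. \<omega> i p v))"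
    if p: "p \<in> U" and s: "s \<in> {1..t}" for p s
    unfolding fund_form_given_by_def
  proof
    fix v assume v: "v \<in> E"
    let ?x = "D (replicate (s + 1) v) p"
    let ?y = "\<Sum>j=d s + 1..N. (\<Sum>I\<in>indices k (s + 1). q p I j * (\<Prod>i\<leftarrow>I. \<omega> i p v)) *s A j p"
    have "?x = (\<Sum>I\<in>indices k (s + 1). (\<Prod>i\<leftarrow>I. \<omega> i p v) *s D (map (e p) I) p)"
      using iterated_multilinear[OF holo_A0 e(1)[OF p] p, of k "\<lambda>m. m" "s + 1" "\<lambda>m. \<omega> m p v"]
      by (simp only: e(3)[OF p v] finite_atLeastAtMost simp_thms)
    then have "coord p j ?x = (\<Sum>I\<in>indices k (s + 1). q p I j * (\<Prod>i\<leftarrow>I. \<omega> i p v))" for j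
      by (simp add: coord_sum[OF p] coord_scale[OF p] q_def mult.commute)
    then have y: "?y = (\<Sum>j=d s + 1..N. coord p j ?x *s A j p)"
      by simp
    have ds: "d s \<le> N" using d_le[OF s] .
    \<comment> \<open>The two representatives differ by the frame components up to \<open>d s\<close>, which lie in the subspace
      divided out.\<close>
    have "?x = (\<Sum>j=0..d s. coord p j ?x *s A j p) + ?y"
      unfolding y using ds coord_expand[OF p, of ?x] sum.ub_add_nat[of 0 "d s" "\<lambda>j. coord p j ?x *s A j p" "N - d s"]
      by simp
    moreover have "(\<Sum>j=0..d s. coord p j ?x *s A j p) \<in> osc s p"
      unfolding flag_osc[OF s p, symmetric] by (intro vec.span_sum vec.span_scale vec.span_base imageI)
    ultimately obtain z where z: "z \<in> osc s p" "?x = z + ?y" by blast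
    have sub: "vec.subspace (osc s p)"
      unfolding osc_space_def by (rule vec.subspace_span)
    have "(+) ?x ` osc s p = (+) ?y ` osc s p"
    proof (intro equalityI subsetI)
      fix w assume "w \<in> (+) ?x ` osc s p"
      then obtain u where u: "u \<in> osc s p" "w = ?x + u" by auto
      then have "w = ?y + (z + u)" "z + u \<in> osc s p"
        using z vec.subspace_add[OF sub z(1) u(1)] by (simp_all add: algebra_simps)
      then show "w \<in> (+) ?y ` osc s p" by blast
    next
      fix w assume "w \<in> (+) ?y ` osc s p"
      then obtain u where u: "u \<in> osc s p" "w = ?y + u" by auto
      then have "w = ?x + (u - z)" "u - z \<in> osc s p"
        using z vec.subspace_diff[OF sub u(1) z(1)] by (simp_all add: algebra_simps)
      then show "w \<in> (+) ?x ` osc s p" by blast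
    qed
    then show "fund_form E (A 0) (s + 1) p v = (+) ?y ` osc_space E (A 0) (s + 1 - 1) p"
      by (simp only: fund_form_def dir_deriv_power add_diff_cancel_right')
  qed
  show ?thesis
    by (intro exI[of _ q] ballI conjI impI form rel_1 rel)
      (auto intro: sym rel)
qed

end

section \<open>The coefficients of the fundamental forms\<close>

theorem lemma3p1:
  fixes V :: "(complex ^ 'n::finite) set set" and N k t :: nat and d :: "nat \<Rightarrow> nat"
  assumes "CARD('n) = N + 1"
    and "irreducible_variety V" and "variety_dim V k"
    and "t \<ge> 1"
    and "d 0 = 0" and "\<And>s. s \<in> {1..t} \<Longrightarrow> generic_osc_dim V k s (d s)"
  shows "generically V (\<lambda>P. \<forall>E U A \<omega> \<Omega>.
    darboux_frame V N k E U A \<longrightarrow> P \<in> (pt \<circ> A 0) ` U \<longrightarrow>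
    (\<forall>s\<in>{1..t}. \<forall>p\<in>U. vec.span ((\<lambda>i. A i p) ` {0..d s}) = osc_space E (A 0) s p) \<longrightarrow>
    frame_forms N k E U A \<omega> \<Omega> \<longrightarrow>
    (\<exists>q :: complex ^ 'n \<Rightarrow> nat list \<Rightarrow> nat \<Rightarrow> complex. \<forall>p\<in>U. \<forall>s\<in>{1..t}.
       fund_form_given_by N (d s) E A (s + 1) p
         (\<lambda>j v. \<Sum>I\<in>indices k (s + 1). q p I j * (\<Prod>i\<leftarrow>I. \<omega> i p v)) \<and>
       (\<forall>I\<in>indices k (s + 1). \<forall>J\<in>indices k (s + 1). \<forall>j\<in>{d s + 1..N}.
          mset I = mset J \<longrightarrow> q p I j = q p J j) \<and>
       (s = 1 \<longrightarrow> (\<forall>i\<in>{1..k}. \<forall>j\<in>{d 1 + 1..N}. \<forall>v\<in>E.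
          \<Omega> i j p v = (\<Sum>m=1..k. q p [i, m] j * \<omega> m p v))) \<and>
       (s \<ge> 2 \<longrightarrow> (\<forall>I\<in>indices k s. \<forall>j\<in>{d s + 1..N}. \<forall>v\<in>E.
          (\<Sum>i=d (s - 1) + 1..d s. q p I i * \<Omega> i j p v) =
          (\<Sum>m=1..k. q p (I @ [m]) j * \<omega> m p v)))))"
proof -
  \<comment> \<open>One exceptional set suffices: that of an order \<open>s0\<close> with \<open>d s0 > N\<close> if there is one, in which case no frame
    exists over a general point, and that of an arbitrary order otherwise.\<close>
  obtain s0 where s0: "s0 \<in> {1..t}" "\<And>s. s \<in> {1..t} \<Longrightarrow> d s > N \<Longrightarrow> d s0 > N"
  proof (cases "\<exists>s\<in>{1..t}. d s > N")
    case True
    then show ?thesis using that by blast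
  next
    case False
    then show ?thesis using that[of 1] assms(4) by auto
  qed
  from assms(6)[OF s0(1)] obtain Z where Z: "zariski_closed Z" "\<not> V \<subseteq> Z"
    "\<And>P E U A0 p. P \<in> V - Z \<Longrightarrow> p \<in> U \<Longrightarrow> local_lift V k E U A0 \<Longrightarrow> pt (A0 p) = P \<Longrightarrow>
       vec.dim (osc_space E A0 s0 p) = d s0 + 1"
    unfolding generic_osc_dim_def generically_def by blast
  show ?thesis
    unfolding generically_def
  proof (rule exI[of _ Z], intro conjI Z(1,2) ballI allI impI)
    fix P E U A \<omega> \<Omega>
    assume P: "P \<in> V - Z" and frame: "darboux_frame V N k E U A" and PU: "P \<in> (pt \<circ> A 0) ` U"
      and osc: "\<forall>s\<in>{1..t}. \<forall>p\<in>U. vec.span ((\<lambda>i. A i p) ` {0..d s}) = osc_space E (A 0) s p"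
      and forms: "frame_forms N k E U A \<omega> \<Omega>"
    have lift: "local_lift V k E U (A 0)"
      using frame by (simp add: darboux_frame_def)
    obtain p where "p \<in> U" "pt (A 0 p) = P"
      using PU by auto
    from Z(3)[OF P this(1) lift this(2)] have "d s0 + 1 \<le> CARD('n)"
      using dim_subset_UNIV_cart_gen[of "osc_space E (A 0) s0 p"] by simp
    then have d_le: "d s \<le> N" if "s \<in> {1..t}" for s
      using s0(2)[OF that] assms(1) by linarith
    interpret osculating_frame E U N A k t d
      by unfold_locales
        (use frame lift osc d_le assms in \<open>auto simp: darboux_frame_def local_lift_def\<close>)
    show "\<exists>q :: complex ^ 'n \<Rightarrow> nat list \<Rightarrow> nat \<Rightarrow> complex. \<forall>p\<in>U. \<forall>s\<in>{1..t}.
       fund_form_given_by N (d s) E A (s + 1) p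
         (\<lambda>j v. \<Sum>I\<in>indices k (s + 1). q p I j * (\<Prod>i\<leftarrow>I. \<omega> i p v)) \<and>
       (\<forall>I\<in>indices k (s + 1). \<forall>J\<in>indices k (s + 1). \<forall>j\<in>{d s + 1..N}.
          mset I = mset J \<longrightarrow> q p I j = q p J j) \<and>
       (s = 1 \<longrightarrow> (\<forall>i\<in>{1..k}. \<forall>j\<in>{d 1 + 1..N}. \<forall>v\<in>E.
          \<Omega> i j p v = (\<Sum>m=1..k. q p [i, m] j * \<omega> m p v))) \<and>
       (s \<ge> 2 \<longrightarrow> (\<forall>I\<in>indices k s. \<forall>j\<in>{d s + 1..N}. \<forall>v\<in>E.
          (\<Sum>i=d (s - 1) + 1..d s. q p I i * \<Omega> i j p v) =
          (\<Sum>m=1..k. q p (I @ [m]) j * \<omega> m p v)))"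
      by (rule fundamental_forms[OF forms])
  qed
qed

end
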